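(* Let $p$ be a prime number, let $F$ be a field of characteristic $p$, let $n\geq 1$, and let $A_1,\dots,A_n$ be cyclic $p$-algebras over $F$ (that is, each $A_i$ is isomorphic to $[\alpha_i,\beta_i)_{p,F}$ for some $\alpha_i\in F$ and $\beta_i\in F^\times$). Then there exist non-zero elements $a_0,a_1,\dots,a_n\in F^\times$ such that $A_i\simeq [a_{i-1},a_i)_{p,F}$ for all $i\in\{1,\dots,n\}$; that is, the algebras can be written as \[[a_0,a_1)_{p,F},\ [a_1,a_2)_{p,F},\ \dots,\ [a_{n-1},a_n)_{p,F}.\]
   Context: For a field $F$ of characteristic $p>0$, $\alpha\in F$ and $\beta\in F^\times$, $[\alpha,\beta)_{p,F}$ denotes the cyclic $p$-algebra, i.e. the $F$-algebra (central simple of degree $p$) generated by two elements $i,j$ subject to the relations $i^p-i=\alpha$, $j^p=\beta$ and $jij^{-1}=i-1$. *)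

theory Defs
  imports "HOL-Algebra.QuotRing" "HOL-Algebra.Module" "HOL-Computational_Algebra.Primes"
begin

text \<open>The same convention as for type classes (\<^const>\<open>semiring_char\<close>): the \<open>Gcd\<close> of
  all \<open>n\<close> annihilating the unit, hence \<open>0\<close> if there is no such positive \<open>n\<close>.\<close>

definition ring_char :: "('a, 'm) ring_scheme \<Rightarrow> nat" where
  "ring_char R = Gcd {n::nat. [n] \<cdot>\<^bsub>R\<^esub> \<one>\<^bsub>R\<^esub> = \<zero>\<^bsub>R\<^esub>}"

text \<open>Unlike the locale \<^locale>\<open>algebra\<close> of the library, multiplication need not be
  commutative.\<close>

locale assoc_algebra = module F A + A?: ring A for F (structure) and A (structure) +
  assumes smult_mult_left:
      "\<lbrakk>c \<in> carrier F; x \<in> carrier A; y \<in> carrier A\<rbrakk> \<Longrightarrow>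
        (c \<odot>\<^bsub>A\<^esub> x) \<otimes>\<^bsub>A\<^esub> y = c \<odot>\<^bsub>A\<^esub> (x \<otimes>\<^bsub>A\<^esub> y)"
    and smult_mult_right:
      "\<lbrakk>c \<in> carrier F; x \<in> carrier A; y \<in> carrier A\<rbrakk> \<Longrightarrow>
        x \<otimes>\<^bsub>A\<^esub> (c \<odot>\<^bsub>A\<^esub> y) = c \<odot>\<^bsub>A\<^esub> (x \<otimes>\<^bsub>A\<^esub> y)"

definition algebra_isomorphic ::
    "('a, 'm) ring_scheme \<Rightarrow> ('a, 'b, 'k) module_scheme \<Rightarrow> ('a, 'c, 'l) module_scheme \<Rightarrow> bool"
  where "algebra_isomorphic F A B \<longleftrightarrow>
    (\<exists>h \<in> ring_iso A B. \<forall>c \<in> carrier F. \<forall>x \<in> carrier A. h (c \<odot>\<^bsub>A\<^esub> x) = c \<odot>\<^bsub>B\<^esub> h x)"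

text \<open>The free associative unital algebra on the generators \<open>'x\<close>: finitely supported
  coefficient functions on words, multiplied by concatenating words, so that the coefficient of
  \<open>w\<close> in a product is a sum over all ways of cutting \<open>w\<close> in two.\<close>

definition free_algebra :: "('a, 'm) ring_scheme \<Rightarrow> ('a, 'x list \<Rightarrow> 'a) module" where
  "free_algebra R = \<lparr>
     carrier = {f. (\<forall>w. f w \<in> carrier R) \<and> finite {w. f w \<noteq> \<zero>\<^bsub>R\<^esub>}},
     monoid.mult = (\<lambda>f g w. \<Oplus>\<^bsub>R\<^esub>k\<in>{..length w}. f (take k w) \<otimes>\<^bsub>R\<^esub> g (drop k w)),
     one = (\<lambda>w. if w = [] then \<one>\<^bsub>R\<^esub> else \<zero>\<^bsub>R\<^esub>),
     zero = (\<lambda>w. \<zero>\<^bsub>R\<^esub>),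
     add = (\<lambda>f g w. f w \<oplus>\<^bsub>R\<^esub> g w),
     smult = (\<lambda>c f w. c \<otimes>\<^bsub>R\<^esub> f w)\<rparr>"

definition free_gen :: "('a, 'm) ring_scheme \<Rightarrow> 'x \<Rightarrow> 'x list \<Rightarrow> 'a" where
  "free_gen R x = (\<lambda>w. if w = [x] then \<one>\<^bsub>R\<^esub> else \<zero>\<^bsub>R\<^esub>)"

text \<open>The quotient by a two-sided ideal. Scalars act on cosets through representatives, in the
  style of \<^const>\<open>rcoset_mult\<close>.\<close>

definition quotient_algebra ::
    "('a, 'b, 'k) module_scheme \<Rightarrow> 'b set \<Rightarrow> ('a, 'b set) module" where
  "quotient_algebra A I = \<lparr>
     carrier = carrier (A Quot I),
     monoid.mult = monoid.mult (A Quot I),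
     one = one (A Quot I),
     zero = zero (A Quot I),
     add = add (A Quot I),
     smult = (\<lambda>c X. \<Union>x\<in>X. I +>\<^bsub>A\<^esub> (c \<odot>\<^bsub>A\<^esub> x))\<rparr>"

datatype cyclic_gen = Gen_i | Gen_j

text \<open>The algebra \<open>[\<alpha>,\<beta>)\<close> over \<open>F\<close>, presented by generators \<open>i\<close>, \<open>j\<close> and relations
  \<open>i\<^sup>p - i = \<alpha>\<close>, \<open>j\<^sup>p = \<beta>\<close>, \<open>j i j\<^sup>-\<^sup>1 = i - 1\<close>. The last one is written
  \<open>j i = (i - 1) j\<close>: for \<open>\<beta> \<noteq> 0\<close> the relation \<open>j\<^sup>p = \<beta>\<close> makes \<open>j\<close> invertible in the quotient.\<close>

definition cyclic_relators ::
    "('a, 'm) ring_scheme \<Rightarrow> nat \<Rightarrow> 'a \<Rightarrow> 'a \<Rightarrow> (cyclic_gen list \<Rightarrow> 'a) set" where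
  "cyclic_relators F p \<alpha> \<beta> =
    (let L = free_algebra F; i = free_gen F Gen_i; j = free_gen F Gen_j in
      {(i [^]\<^bsub>L\<^esub> p \<ominus>\<^bsub>L\<^esub> i) \<ominus>\<^bsub>L\<^esub> \<alpha> \<odot>\<^bsub>L\<^esub> \<one>\<^bsub>L\<^esub>,
       j [^]\<^bsub>L\<^esub> p \<ominus>\<^bsub>L\<^esub> \<beta> \<odot>\<^bsub>L\<^esub> \<one>\<^bsub>L\<^esub>,
       j \<otimes>\<^bsub>L\<^esub> i \<ominus>\<^bsub>L\<^esub> (i \<ominus>\<^bsub>L\<^esub> \<one>\<^bsub>L\<^esub>) \<otimes>\<^bsub>L\<^esub> j})"

definition cyclic_symbol ::
    "('a, 'm) ring_scheme \<Rightarrow> nat \<Rightarrow> 'a \<Rightarrow> 'a \<Rightarrow> ('a, (cyclic_gen list \<Rightarrow> 'a) set) module" where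
  "cyclic_symbol F p \<alpha> \<beta> =
    quotient_algebra (free_algebra F) (Idl\<^bsub>free_algebra F\<^esub> (cyclic_relators F p \<alpha> \<beta>))"

definition cyclic_p_algebra ::
    "('a, 'm) ring_scheme \<Rightarrow> nat \<Rightarrow> ('a, 'b, 'k) module_scheme \<Rightarrow> bool" where
  "cyclic_p_algebra F p A \<longleftrightarrow> assoc_algebra F A \<and>
    (\<exists>\<alpha> \<in> carrier F. \<exists>\<beta> \<in> carrier F - {\<zero>\<^bsub>F\<^esub>}. algebra_isomorphic F A (cyclic_symbol F p \<alpha> \<beta>))"

end

theory Submission
  imports Defs "HOL-Algebra.Multiplicative_Group" "HOL-Number_Theory.Residues"
    "HOL-Computational_Algebra.Polynomial"
begin

text \<open>If \<open>y x = (x - 1) y\<close> in characteristic \<open>p\<close>, then \<open>(x y)\<^sup>p = (x\<^sup>p - x) y\<^sup>p\<close>. Changing the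
  generators \<open>i\<close>, \<open>j\<close> of \<open>[\<alpha>,\<beta>)\<close> to \<open>i + d\<close>, \<open>j\<close>, or to \<open>i + c j\<^sup>-\<^sup>1\<close>, \<open>j\<close>, or to \<open>i\<close>, \<open>i j\<close>, this gives
  \<open>[\<alpha>,\<beta>) \<cong> [\<alpha> + d\<^sup>p - d, \<beta>)\<close>, \<open>[\<alpha>,\<beta>) \<cong> [\<alpha> + c\<^sup>p/\<beta>, \<beta>)\<close> and \<open>[\<alpha>,\<beta>) \<cong> [\<alpha>, \<alpha>\<beta>)\<close> if \<open>\<alpha> \<noteq> 0\<close>.
  To link \<open>[\<alpha>,\<beta>)\<close> to \<open>[\<gamma>,\<delta>)\<close>, put \<open>d = \<gamma> - \<alpha>\<beta>\<close> and \<open>b = \<alpha>\<beta> + d\<^sup>p = \<gamma> + d\<^sup>p - d\<close>: then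
  \<open>[\<alpha>,\<beta>) \<cong> [b/\<beta>,\<beta>) \<cong> [b/\<beta>,b)\<close> and \<open>[\<gamma>,\<delta>) \<cong> [b,\<delta>)\<close>. As the second slot \<open>\<delta>\<close> is kept, a chain
  starting with \<open>[\<gamma>,\<delta>)\<close> can be extended to the left.\<close>

section \<open>Rings of prime characteristic\<close>

text \<open>Over the field with \<open>p\<close> elements a nonzero polynomial has at most as many
  roots as its degree; this is the integral form. Splitting off \<open>X - a\<close> at one point,
  primality and incongruence make the other points roots of the quotient modulo
  \<open>p\<close>.\<close>

lemma prime_const_dvd_poly:
  fixes f :: "int poly"
  assumes p: "prime p" and A: "finite A" "degree f < card A"
    and root: "\<And>a. a \<in> A \<Longrightarrow> p dvd poly f a"
    and inj: "\<And>a b. a \<in> A \<Longrightarrow> b \<in> A \<Longrightarrow> p dvd a - b \<Longrightarrow> a = b"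
  shows "[:p:] dvd f"
  using A root inj
proof (induction "degree f" arbitrary: f A)
  case 0
  then obtain c a where "f = [:c:]" "a \<in> A"
    by (metis card_gt_0_iff degree_eq_zeroE ex_in_conv)
  with 0 show ?case by (auto simp: const_poly_dvd_const_poly_iff)
next
  case (Suc n)
  obtain a where a: "a \<in> A" using Suc.prems(2) by fastforce
  define q where "q = synthetic_div f a"
  have f: "f = [:-a, 1:] * q + [:poly f a:]"
    using synthetic_div_correct'[of a f] by (simp add: q_def)
  have "[:p:] dvd q"
  proof (rule Suc.hyps(1))
    show "n = degree q" using Suc.hyps(2) by (simp add: q_def degree_synthetic_div)
    show "finite (A - {a})" using Suc.prems by simp
    show "degree q < card (A - {a})"
      using Suc.hyps(2) Suc.prems(1,2) a by (simp add: q_def degree_synthetic_div)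
    show "p dvd poly q b" if "b \<in> A - {a}" for b
    proof -
      have "poly f b = (b - a) * poly q b + poly f a" by (subst f) (simp add: algebra_simps)
      then have "p dvd (b - a) * poly q b"
        using Suc.prems(3)[of b] Suc.prems(3)[OF a] that
        by (metis Diff_iff add_diff_cancel_right' dvd_diff)
      then show ?thesis
        using p Suc.prems(4)[of b a] that a by (auto simp: prime_dvd_mult_iff)
    qed
  qed (use Suc.prems in auto)
  moreover have "[:p:] dvd [:poly f a:]"
    using Suc.prems(3)[OF a] by (simp add: const_poly_dvd_const_poly_iff)
  ultimately show ?case by (subst f) (intro dvd_add dvd_mult)
qed

text \<open>Both polynomials are monic of degree \<open>p\<close>, so their difference has smaller
  degree. It vanishes modulo \<open>p\<close> at \<open>0, ..., p - 1\<close>: the product has a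
  zero factor there, and \<open>X^p - X\<close> vanishes by Fermat.\<close>

lemma prime_const_dvd_falling_factorial:
  assumes p: "prime p"
  shows "[:int p:] dvd (\<Prod>k<p. [:- int k, 1:]) - (monom 1 p - monom 1 1)"
proof (rule prime_const_dvd_poly)
  define P where "P = (\<Prod>k<p. [:- int k, 1:])"
  have p2: "p \<ge> 2" using p prime_ge_2_nat by blast
  have dP: "degree P = p" unfolding P_def by (simp add: degree_prod_eq_sum_degree)
  have "lead_coeff P = 1" unfolding P_def lead_coeff_prod by simp
  with dP have "coeff (P - monom 1 p) p = 0" by simp
  moreover have "degree (P - monom 1 p) \<le> p"
    by (rule degree_diff_le) (simp_all add: dP degree_monom_le)
  \<comment> \<open>Degree exactly \<open>p\<close> would make the leading coefficient zero, hence
    the polynomial zero and its degree 0.\<close>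
  ultimately have dP': "degree (P - monom 1 p) < p"
    using p2 by (metis degree_0 leading_coeff_0_iff le_neq_implies_less less_le_trans pos2)
  show "degree ((\<Prod>k<p. [:- int k, 1:]) - (monom 1 p - monom 1 1)) < card (int ` {..<p})"
  proof -
    have "(\<Prod>k<p. [:- int k, 1:]) - (monom 1 p - monom 1 1) = (P - monom 1 p) + monom 1 1"
      by (simp add: P_def)
    moreover have "degree (monom (1::int) 1) < p" using p2 by (simp add: degree_monom_eq)
    ultimately show ?thesis using dP'
      by (simp only: card_image inj_on_of_nat card_lessThan degree_add_less)
  qed
  show "prime (int p)" using p by simp
  show "finite (int ` {..<p})" by simp
  show "a = b" if "a \<in> int ` {..<p}" "b \<in> int ` {..<p}" "int p dvd a - b" for a b
    using that by (auto simp flip: mod_eq_dvd_iff) 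
  show "int p dvd poly ((\<Prod>k<p. [:- int k, 1:]) - (monom 1 p - monom 1 1)) a"
    if a: "a \<in> int ` {..<p}" for a
  proof -
    obtain n where n: "a = int n" "n < p" using a by auto
    have "(\<Prod>k<p. int n - int k) = 0" using n(2) by (auto simp: prod_zero_iff)
    have "[n ^ p = n] (mod p)"
    proof (cases "p dvd n")
      case True
      then have "p dvd n ^ p" using p2 by (simp add: dvd_power_le dvd_trans[OF _ dvd_power])
      with True show ?thesis by (simp add: cong_def)
    next
      case False
      then have "[n ^ (p - 1) * n = 1 * n] (mod p)"
        using p fermat_theorem cong_mult cong_refl by blast
      then show ?thesis using p2 by (simp add: power_eq_if mult.commute)
    qed
    then have "int p dvd int n ^ p - int n"
      by (metis cong_iff_dvd_diff cong_int_iff of_nat_power)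
    with \<open>(\<Prod>k<p. int n - int k) = 0\<close> have "poly ((\<Prod>k<p. [:- int k, 1:]) - (monom 1 p - monom 1 1)) a = - (int n ^ p - int n)"
      by (simp add: n poly_prod poly_monom)
    with \<open>int p dvd int n ^ p - int n\<close> show ?thesis by (simp only: dvd_minus_iff)
  qed
qed

section \<open>Integer polynomials at ring elements and the shift identity\<close>

context ring
begin

text \<open>Horner's scheme. The ring may be noncommutative, but integer multiples of
  \<open>\<one>\<close> are central, so evaluation at a fixed element still respects sums and
  products.\<close>

definition int_poly_eval :: "'a \<Rightarrow> int poly \<Rightarrow> 'a" where
  "int_poly_eval x f = fold_coeffs (\<lambda>a r. [a] \<cdot> \<one> \<oplus> x \<otimes> r) f \<zero>"

lemma int_poly_eval_0 [simp]: "int_poly_eval x 0 = \<zero>"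
  by (simp add: int_poly_eval_def)

lemma int_poly_eval_pCons:
  "x \<in> carrier R \<Longrightarrow> int_poly_eval x (pCons a f) = [a] \<cdot> \<one> \<oplus> x \<otimes> int_poly_eval x f"
  by (cases "a = 0 \<and> f = 0") (auto simp: int_poly_eval_def add_pow_int_ge)

lemma int_poly_eval_closed [simp]:
  "x \<in> carrier R \<Longrightarrow> int_poly_eval x f \<in> carrier R"
  by (induction f) (simp_all add: int_poly_eval_pCons)

lemma int_poly_eval_add:
  assumes x: "x \<in> carrier R"
  shows "int_poly_eval x (f + g) = int_poly_eval x f \<oplus> int_poly_eval x g"
proof (induction f g rule: poly_induct2)
  case (pCons a f b g)
  then show ?case using x
    by (simp add: int_poly_eval_pCons add.int_pow_mult r_distr a_assoc add.m_lcomm)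
qed simp

lemma int_poly_eval_smult:
  assumes x: "x \<in> carrier R"
  shows "int_poly_eval x (smult a f) = [a] \<cdot> \<one> \<otimes> int_poly_eval x f"
proof (induction f)
  case (pCons b f)
  have "[(a * b)] \<cdot> \<one> = ([a] \<cdot> \<one>) \<otimes> ([b] \<cdot> \<one>)"
    by (simp add: add_pow_ldistr_int add.int_pow_pow mult.commute)
  moreover have "x \<otimes> (([a] \<cdot> \<one>) \<otimes> y) = ([a] \<cdot> \<one>) \<otimes> (x \<otimes> y)" if "y \<in> carrier R" for y
    using x that by (simp add: add_pow_ldistr_int add_pow_rdistr_int)
  ultimately show ?case using x pCons
    by (simp add: int_poly_eval_pCons r_distr)
qed simp

lemma int_poly_eval_mult:
  assumes x: "x \<in> carrier R"
  shows "int_poly_eval x (f * g) = int_poly_eval x f \<otimes> int_poly_eval x g"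
proof (induction f)
  case (pCons a f)
  then show ?case using x
    by (simp add: int_poly_eval_pCons int_poly_eval_add int_poly_eval_smult l_distr m_assoc add_pow_int_ge)
qed (use x in simp)

lemma int_poly_eval_monom:
  "x \<in> carrier R \<Longrightarrow> int_poly_eval x (monom 1 n) = x [^] n"
proof (induction n)
  case 0
  then show ?case by (simp add: monom_0 int_poly_eval_pCons)
next
  case (Suc n)
  then show ?case by (simp add: monom_Suc int_poly_eval_pCons add_pow_int_ge del: nat_pow_Suc flip: nat_pow_Suc2)
qed

text \<open>Each \<open>y\<close> that \<open>x\<close> crosses lowers it by one. The integer
  multiple of \<open>\<one>\<close> is the form in which \<open>int_poly_eval\<close> produces the
  factor \<open>x - m\<close>.\<close>

lemma shift_commute_pow:
  assumes x: "x \<in> carrier R" and y: "y \<in> carrier R" and c: "y \<otimes> x = (x \<ominus> \<one>) \<otimes> y"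
  shows "y [^] (m::nat) \<otimes> x = (x \<oplus> [(- int m)] \<cdot> \<one>) \<otimes> y [^] m"
proof (induction m)
  case (Suc m)
  have "y [^] Suc m \<otimes> x = y [^] m \<otimes> (y \<otimes> x)" using x y by (simp add: m_assoc)
  also have "\<dots> = (y [^] m \<otimes> x) \<otimes> y \<ominus> y [^] m \<otimes> y"
    unfolding c using x y by (simp add: m_assoc minus_eq l_distr r_distr l_minus r_minus)
  also have "\<dots> = (x \<oplus> [(- int m)] \<cdot> \<one> \<oplus> \<ominus> \<one>) \<otimes> y [^] Suc m"
    unfolding Suc using x y by (simp add: m_assoc minus_eq l_distr l_minus)
  also have "x \<oplus> [(- int m)] \<cdot> \<one> \<oplus> \<ominus> \<one> = x \<oplus> [(- int (Suc m))] \<cdot> \<one>"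
  proof -
    have "- int (Suc m) = - int m + - 1" by simp
    then have "[(- int (Suc m))] \<cdot> \<one> = [(- int m)] \<cdot> \<one> \<oplus> [(- 1 :: int)] \<cdot> \<one>"
      by (simp only: add.int_pow_mult one_closed)
    moreover have "[(- 1 :: int)] \<cdot> \<one> = \<ominus> \<one>"
      using add.int_pow_neg[of \<one> 1] by simp
    ultimately show ?thesis using x by (simp only: a_assoc a_inv_closed one_closed add.int_pow_closed)
  qed
  finally show ?case .
qed (use x in \<open>simp add: add_pow_int_ge\<close>)

text \<open>Moving every \<open>y\<close> to the right turns \<open>(x y)\<^sup>p\<close> into the product of the \<open>x - k\<close>, \<open>k < p\<close>,
  times \<open>y\<^sup>p\<close>.\<close>

lemma shift_commute_mult_pow_char:
  fixes p :: nat
  assumes p: "prime p" "[p] \<cdot> \<one> = \<zero>"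
    and x: "x \<in> carrier R" and y: "y \<in> carrier R" and c: "y \<otimes> x = (x \<ominus> \<one>) \<otimes> y"
  shows "(x \<otimes> y) [^] p = (x [^] p \<ominus> x) \<otimes> y [^] p"
proof -
  let ?P = "\<lambda>m. \<Prod>k<m. [:- int k, 1:]"
  have "(x \<otimes> y) [^] m = int_poly_eval x (?P m) \<otimes> y [^] m" for m :: nat
  proof (induction m)
    case 0
    show ?case using x by (simp add: one_pCons int_poly_eval_pCons)
  next
    case (Suc m)
    have "(x \<otimes> y) [^] Suc m = int_poly_eval x (?P m) \<otimes> (y [^] m \<otimes> x) \<otimes> y"
      using x y Suc by (simp add: m_assoc)
    also have "\<dots> = int_poly_eval x (?P m) \<otimes> (x \<oplus> [(- int m)] \<cdot> \<one>) \<otimes> y [^] Suc m"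
      using x y by (simp add: shift_commute_pow[OF x y c] m_assoc)
    also have "x \<oplus> [(- int m)] \<cdot> \<one> = int_poly_eval x [:- int m, 1:]"
      using x by (simp add: int_poly_eval_pCons a_comm)
    finally show ?case
      using x by (simp add: int_poly_eval_mult del: mult_pCons_left mult_pCons_right)
  qed
  \<comment> \<open>The falling factorial is \<open>X^p - X\<close> up to a multiple of
    \<open>p\<close>, and such a multiple evaluates to zero because
    \<open>[p] \<cdot> \<one> = \<zero>\<close>.\<close>
  moreover obtain g where "?P p - (monom 1 p - monom 1 1) = [:int p:] * g"
    using prime_const_dvd_falling_factorial[OF p(1)] by blast
  then have "?P p = monom 1 p + smult (- 1) (monom 1 1) + smult (int p) g"
    by (simp add: algebra_simps)
  then have "int_poly_eval x (?P p) = x [^] p \<ominus> x"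
    using x p(2) by (simp only: int_poly_eval_add int_poly_eval_smult int_poly_eval_monom)
      (simp add: minus_eq add.int_pow_neg l_minus add_pow_int_ge)
  ultimately show ?thesis by simp
qed

section \<open>The binomial theorem and Frobenius for commuting elements\<close>

lemma commute_binomial:
  assumes x: "x \<in> carrier R" and y: "y \<in> carrier R" and c: "x \<otimes> y = y \<otimes> x"
  shows "(x \<oplus> y) [^] (n::nat) = (\<Oplus>k\<in>{..n}. [(n choose k)] \<cdot> (x [^] k \<otimes> y [^] (n - k)))"
proof (induction n)
  case 0
  show ?case using x y by simp
next
  case (Suc n)
  let ?u = "\<lambda>k. x [^] k \<otimes> y [^] (n - k)"
  let ?v = "\<lambda>k. x [^] k \<otimes> y [^] (Suc n - k)"
  have yx: "y [^] (m::nat) \<otimes> x = x \<otimes> y [^] m" for m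
    using group_commutes_pow[OF c[symmetric] y x] .
  have ux: "?u k \<otimes> x = ?v (Suc k)" for k
    using x y by (simp add: m_assoc yx)
  have uy: "?u k \<otimes> y = ?v k" if "k \<le> n" for k
    using x y that by (simp add: m_assoc Suc_diff_le)
  have "(x \<oplus> y) [^] Suc n = (\<Oplus>k\<in>{..n}. [(n choose k)] \<cdot> ?u k) \<otimes> x \<oplus> (\<Oplus>k\<in>{..n}. [(n choose k)] \<cdot> ?u k) \<otimes> y"
    using x y Suc by (simp add: r_distr)
  also have "(\<Oplus>k\<in>{..n}. [(n choose k)] \<cdot> ?u k) \<otimes> x = (\<Oplus>k\<in>{..n}. [(n choose k)] \<cdot> ?v (Suc k))"
    using x y by (subst finsum_ldistr) (auto simp: add_pow_ldistr ux intro!: finsum_cong')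
  also have "(\<Oplus>k\<in>{..n}. [(n choose k)] \<cdot> ?u k) \<otimes> y = (\<Oplus>k\<in>{..n}. [(n choose k)] \<cdot> ?v k)"
    using x y by (subst finsum_ldistr) (auto simp: add_pow_ldistr uy intro!: finsum_cong')
  \<comment> \<open>The new last term has coefficient \<open>n choose Suc n\<close>, which is zero.
    Splitting off the term at 0 afterwards aligns the two sums for Pascal's rule.\<close>
  also have "\<dots> = (\<Oplus>k\<in>{..Suc n}. [(n choose k)] \<cdot> ?v k)"
    using x y by (subst finsum_Suc) (auto simp: binomial_eq_0)
  also have "\<dots> = (\<Oplus>k\<in>{..n}. [(n choose Suc k)] \<cdot> ?v (Suc k)) \<oplus> ?v 0"
    using x y by (subst finsum_Suc2) auto
  also have "(\<Oplus>k\<in>{..n}. [(n choose k)] \<cdot> ?v (Suc k)) \<oplus> \<dots> =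
      (\<Oplus>k\<in>{..n}. [(Suc n choose Suc k)] \<cdot> ?v (Suc k)) \<oplus> ?v 0"
    using x y by (simp add: a_assoc finsum_addf flip: add.nat_pow_mult)
  also have "\<dots> = (\<Oplus>k\<in>{..Suc n}. [(Suc n choose k)] \<cdot> ?v k)"
    using x y by (subst finsum_Suc2) auto
  finally show ?case .
qed

text \<open>The inner binomial coefficients are divisible by \<open>p\<close>, and \<open>p\<close>
  annihilates every element since it annihilates \<open>\<one>\<close>. Only the two outer terms
  remain.\<close>

lemma frobenius_add:
  fixes p :: nat
  assumes p: "prime p" "[p] \<cdot> \<one> = \<zero>"
    and x: "x \<in> carrier R" and y: "y \<in> carrier R" and c: "x \<otimes> y = y \<otimes> x"
  shows "(x \<oplus> y) [^] p = x [^] p \<oplus> y [^] p"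
proof -
  have p0: "p > 0" using p prime_gt_0_nat by blast
  have zero: "[m] \<cdot> z = \<zero>" if m: "p dvd m" and z: "z \<in> carrier R" for m :: nat and z
  proof -
    obtain l where "m = p * l" using m unfolding dvd_def by blast
    then have "[m] \<cdot> z = [l] \<cdot> (([p] \<cdot> \<one>) \<otimes> z)"
      using z by (simp add: add_pow_ldistr add.nat_pow_pow)
    then show ?thesis using z p by (simp add: add.nat_pow_one)
  qed
  let ?t = "\<lambda>k. [(p choose k)] \<cdot> (x [^] k \<otimes> y [^] (p - k))"
  have "(x \<oplus> y) [^] p = (\<Oplus>k\<in>{..p}. ?t k)"
    by (rule commute_binomial[OF x y c])
  also have "\<dots> = (\<Oplus>k\<in>{0, p}. ?t k)"
  proof (rule add.finprod_mono_neutral_cong_right)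
    show "?t k = \<zero>" if "k \<in> {..p} - {0, p}" for k
      using that x y p by (intro zero dvd_choose_prime) auto
  qed (use x y in auto)
  also have "\<dots> = x [^] p \<oplus> y [^] p"
    using x y p0 by (simp add: a_comm)
  finally show ?thesis .
qed

end

section \<open>Algebra homomorphisms and free algebras\<close>

definition alg_hom ::
    "('a, 'm) ring_scheme \<Rightarrow> ('a, 'b, 'k) module_scheme \<Rightarrow> ('a, 'c, 'l) module_scheme \<Rightarrow> ('b \<Rightarrow> 'c) set"
  where "alg_hom F A B =
    {h \<in> ring_hom A B. \<forall>c \<in> carrier F. \<forall>x \<in> carrier A. h (c \<odot>\<^bsub>A\<^esub> x) = c \<odot>\<^bsub>B\<^esub> h x}"

lemma algebra_isomorphicI:
  assumes h: "h \<in> alg_hom F A B" and g: "g \<in> alg_hom F B A"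
    and gh: "\<And>x. x \<in> carrier A \<Longrightarrow> g (h x) = x" and hg: "\<And>y. y \<in> carrier B \<Longrightarrow> h (g y) = y"
  shows "algebra_isomorphic F A B"
proof -
  have "bij_betw h (carrier A) (carrier B)"
    using h g gh hg by (intro bij_betw_byWitness[where f' = g]) (auto simp: alg_hom_def ring_hom_def)
  then show ?thesis
    using h unfolding algebra_isomorphic_def alg_hom_def ring_iso_def by blast
qed

lemma algebra_isomorphic_trans:
  assumes "algebra_isomorphic F A B" "algebra_isomorphic F B C"
  shows "algebra_isomorphic F A C"
proof -
  obtain f g where f: "f \<in> ring_iso A B" "\<forall>c \<in> carrier F. \<forall>x \<in> carrier A. f (c \<odot>\<^bsub>A\<^esub> x) = c \<odot>\<^bsub>B\<^esub> f x"
    and g: "g \<in> ring_iso B C" "\<forall>c \<in> carrier F. \<forall>x \<in> carrier B. g (c \<odot>\<^bsub>B\<^esub> x) = c \<odot>\<^bsub>C\<^esub> g x"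
    using assms unfolding algebra_isomorphic_def by blast
  have "g \<circ> f \<in> ring_iso A C" using f(1) g(1) by (rule ring_iso_set_trans)
  moreover have "f x \<in> carrier B" if "x \<in> carrier A" for x
    using f(1) that by (rule ring_iso_memE)
  ultimately show ?thesis
    unfolding algebra_isomorphic_def using f(2) g(2) by (intro bexI[of _ "g \<circ> f"]) auto
qed

lemma alg_hom_comp:
  "f \<in> alg_hom F A B \<Longrightarrow> g \<in> alg_hom F B C \<Longrightarrow> g \<circ> f \<in> alg_hom F A C"
  unfolding alg_hom_def using ring_hom_trans[of f A B g C] ring_hom_closed[of f A B] by auto

lemma id_alg_hom: "(\<lambda>x. x) \<in> alg_hom F A A"
  by (simp add: alg_hom_def ring_hom_def)

section \<open>Terms and the algebra structure of the free algebra\<close>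

definition free_monom :: "('a, 'm) ring_scheme \<Rightarrow> 'a \<Rightarrow> 'x list \<Rightarrow> 'x list \<Rightarrow> 'a" where
  "free_monom R c w = (\<lambda>u. if u = w then c else \<zero>\<^bsub>R\<^esub>)"

context cring
begin

abbreviation FA :: "('a, 'x list \<Rightarrow> 'a) module" where "FA \<equiv> free_algebra R"

lemma free_carrierD:
  "f \<in> carrier FA \<Longrightarrow> f w \<in> carrier R" "f \<in> carrier FA \<Longrightarrow> finite {w. f w \<noteq> \<zero>}"
  by (simp_all add: free_algebra_def)

lemma free_monom_closed [simp]: "c \<in> carrier R \<Longrightarrow> free_monom R c w \<in> carrier FA"
  by (simp add: free_algebra_def free_monom_def)

lemma free_gen_eq: "free_gen R x = free_monom R \<one> [x]"
  by (simp add: free_gen_def free_monom_def)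

lemma free_one_eq: "\<one>\<^bsub>FA\<^esub> = free_monom R \<one> []"
  by (simp add: free_algebra_def free_monom_def)

lemma free_zero_closed [simp]: "\<zero>\<^bsub>FA\<^esub> \<in> carrier FA"
  by (simp add: free_algebra_def)

lemma free_add_closed [simp]:
  assumes "f \<in> carrier FA" "g \<in> carrier FA"
  shows "f \<oplus>\<^bsub>FA\<^esub> g \<in> carrier FA"
proof -
  have "{w. f w \<oplus> g w \<noteq> \<zero>} \<subseteq> {w. f w \<noteq> \<zero>} \<union> {w. g w \<noteq> \<zero>}" by auto
  then show ?thesis using assms
    by (auto simp: free_algebra_def intro: finite_subset)
qed

lemma free_smult_closed [simp]:
  assumes "c \<in> carrier R" "f \<in> carrier FA"
  shows "c \<odot>\<^bsub>FA\<^esub> f \<in> carrier FA"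
proof -
  have "{w. c \<otimes> f w \<noteq> \<zero>} \<subseteq> {w. f w \<noteq> \<zero>}" using assms by auto
  then show ?thesis using assms
    by (auto simp: free_algebra_def intro: finite_subset)
qed

text \<open>A nonzero coefficient at \<open>w\<close> requires a cut of \<open>w\<close> into a word
  from each support, so the support of the product lies in the image of a finite set of pairs under
  concatenation.\<close>

lemma free_mult_closed [simp]:
  assumes f: "f \<in> carrier FA" and g: "g \<in> carrier FA"
  shows "f \<otimes>\<^bsub>FA\<^esub> g \<in> carrier FA"
proof -
  let ?S = "(\<lambda>(u, v). u @ v) ` ({w. f w \<noteq> \<zero>} \<times> {w. g w \<noteq> \<zero>})"
  have "(f \<otimes>\<^bsub>FA\<^esub> g) w = \<zero>" if w: "w \<notin> ?S" for w
  proof -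
    have "f (take k w) \<otimes> g (drop k w) = \<zero>" for k
    proof (rule ccontr)
      assume "f (take k w) \<otimes> g (drop k w) \<noteq> \<zero>"
      then have "f (take k w) \<noteq> \<zero>" "g (drop k w) \<noteq> \<zero>"
        using free_carrierD(1)[OF f] free_carrierD(1)[OF g] by auto
      then have "w \<in> ?S" by (force simp: image_iff intro: exI[of _ "take k w"])
      with w show False by simp
    qed
    then show ?thesis by (simp add: free_algebra_def)
  qed
  then have "{w. (f \<otimes>\<^bsub>FA\<^esub> g) w \<noteq> \<zero>} \<subseteq> ?S" by blast
  moreover have "finite ?S" using f g free_carrierD(2) by blast
  ultimately have "finite {w. (f \<otimes>\<^bsub>FA\<^esub> g) w \<noteq> \<zero>}" by (rule finite_subset)
  moreover have "(f \<otimes>\<^bsub>FA\<^esub> g) w \<in> carrier R" for w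
    using free_carrierD(1)[OF f] free_carrierD(1)[OF g] by (auto simp: free_algebra_def)
  ultimately show ?thesis by (simp add: free_algebra_def)
qed

text \<open>In the convolution sum only the cut of \<open>u @ v\<close> directly after
  \<open>u\<close> contributes; any other word has no contributing cut.\<close>

lemma free_mult_monom:
  assumes "c \<in> carrier R" "d \<in> carrier R"
  shows "free_monom R c u \<otimes>\<^bsub>FA\<^esub> free_monom R d v = free_monom R (c \<otimes> d) (u @ v)"
proof
  fix w
  let ?t = "\<lambda>k. free_monom R c u (take k w) \<otimes> free_monom R d v (drop k w)"
  show "(free_monom R c u \<otimes>\<^bsub>FA\<^esub> free_monom R d v) w = free_monom R (c \<otimes> d) (u @ v) w"
  proof (cases "w = u @ v")
    case True
    have "?t k = (if length u = k then c \<otimes> d else \<zero>)" if "k \<in> {..length w}" for k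
    proof (cases "length u = k")
      case False
      then have "length (take k w) \<noteq> length u" using that by auto
      then have "take k w \<noteq> u" by metis
      with False assms show ?thesis by (simp add: free_monom_def)
    qed (use assms True in \<open>auto simp: free_monom_def\<close>)
    then have "(\<Oplus>k\<in>{..length w}. ?t k) = (\<Oplus>k\<in>{..length w}. if length u = k then c \<otimes> d else \<zero>)"
      using assms by (intro finsum_cong') auto
    also have "\<dots> = c \<otimes> d"
      using assms True by (intro finsum_singleton) auto
    finally show ?thesis using True by (simp add: free_algebra_def free_monom_def)
  next
    case False
    then have "?t k = \<zero>" for k
      using assms by (auto simp: free_monom_def)
    then show ?thesis using False by (simp add: free_algebra_def) (simp add: free_monom_def)
  qed
qed

lemma free_smult_monom:
  "c \<in> carrier R \<Longrightarrow> d \<in> carrier R \<Longrightarrow> c \<odot>\<^bsub>FA\<^esub> free_monom R d w = free_monom R (c \<otimes> d) w"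
  by (auto simp: free_algebra_def free_monom_def)

lemma free_l_distr:
  assumes "f \<in> carrier FA" "g \<in> carrier FA" "h \<in> carrier FA"
  shows "(f \<oplus>\<^bsub>FA\<^esub> g) \<otimes>\<^bsub>FA\<^esub> h = f \<otimes>\<^bsub>FA\<^esub> h \<oplus>\<^bsub>FA\<^esub> g \<otimes>\<^bsub>FA\<^esub> h"
  using assms[THEN free_carrierD(1)]
  by (auto simp: free_algebra_def l_distr finsum_addf)

lemma free_r_distr:
  assumes "f \<in> carrier FA" "g \<in> carrier FA" "h \<in> carrier FA"
  shows "h \<otimes>\<^bsub>FA\<^esub> (f \<oplus>\<^bsub>FA\<^esub> g) = h \<otimes>\<^bsub>FA\<^esub> f \<oplus>\<^bsub>FA\<^esub> h \<otimes>\<^bsub>FA\<^esub> g"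
  using assms[THEN free_carrierD(1)]
  by (auto simp: free_algebra_def r_distr finsum_addf)

lemma free_smult_r_distr:
  assumes "f \<in> carrier FA" "g \<in> carrier FA" "c \<in> carrier R"
  shows "c \<odot>\<^bsub>FA\<^esub> (f \<oplus>\<^bsub>FA\<^esub> g) = c \<odot>\<^bsub>FA\<^esub> f \<oplus>\<^bsub>FA\<^esub> c \<odot>\<^bsub>FA\<^esub> g"
  using assms(1,2)[THEN free_carrierD(1)] assms(3)
  by (auto simp: free_algebra_def r_distr)

text \<open>Induction on a finite set containing the support: one word is split off as a term and
  its coefficient is set to zero. Additive identities thus reduce to single terms.\<close>

lemma free_induct [consumes 1, case_names monom add]:
  assumes f: "f \<in> carrier FA"
    and monom: "\<And>c w. c \<in> carrier R \<Longrightarrow> P (free_monom R c w)"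
    and add: "\<And>f g. f \<in> carrier FA \<Longrightarrow> g \<in> carrier FA \<Longrightarrow> P f \<Longrightarrow> P g \<Longrightarrow> P (f \<oplus>\<^bsub>FA\<^esub> g)"
  shows "P f"
proof -
  have "P f" if "finite S" "f \<in> carrier FA" "{w. f w \<noteq> \<zero>} \<subseteq> S" for S f
    using that
  proof (induction S arbitrary: f)
    case empty
    then have "f = free_monom R \<zero> []" by (auto simp: free_monom_def)
    then show ?case by (simp add: monom)
  next
    case (insert w S)
    have fc: "f u \<in> carrier R" for u using insert.prems free_carrierD by blast
    have "{u. (f(w := \<zero>)) u \<noteq> \<zero>} \<subseteq> {u. f u \<noteq> \<zero>}" by auto
    then have "f(w := \<zero>) \<in> carrier FA"
      using insert.prems(1) by (auto simp: free_algebra_def intro: finite_subset)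
    moreover have "{u. (f(w := \<zero>)) u \<noteq> \<zero>} \<subseteq> S" using insert.prems(2) by auto
    ultimately have "P (free_monom R (f w) w \<oplus>\<^bsub>FA\<^esub> f(w := \<zero>))"
      using fc by (intro add monom insert.IH free_monom_closed)
    moreover have "free_monom R (f w) w \<oplus>\<^bsub>FA\<^esub> f(w := \<zero>) = f"
      using fc by (auto simp: free_algebra_def free_monom_def)
    ultimately show ?case by simp
  qed
  from this[OF free_carrierD(2)[OF f] f] show ?thesis by simp
qed

text \<open>Both sides are additive in each argument; on terms the claim is associativity of
  concatenation and of the multiplication of coefficients.\<close>

lemma free_m_assoc:
  assumes "f \<in> carrier FA" "g \<in> carrier FA" "h \<in> carrier FA"
  shows "(f \<otimes>\<^bsub>FA\<^esub> g) \<otimes>\<^bsub>FA\<^esub> h = f \<otimes>\<^bsub>FA\<^esub> (g \<otimes>\<^bsub>FA\<^esub> h)"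
  using assms
proof (induction f rule: free_induct)
  case (monom c u)
  from monom(2,1,3) show ?case
  proof (induction g rule: free_induct)
    case (monom d v)
    from monom(3,1,2) show ?case
    proof (induction h rule: free_induct)
      case (monom e w)
      then show ?case by (simp add: free_mult_monom m_assoc)
    qed (simp add: free_r_distr)
  qed (simp add: free_r_distr free_l_distr)
qed (simp add: free_l_distr)

lemma free_l_one:
  assumes "f \<in> carrier FA"
  shows "\<one>\<^bsub>FA\<^esub> \<otimes>\<^bsub>FA\<^esub> f = f"
  using assms unfolding free_one_eq
  by (induction rule: free_induct) (simp_all add: free_mult_monom free_r_distr)

lemma free_r_one:
  assumes "f \<in> carrier FA"
  shows "f \<otimes>\<^bsub>FA\<^esub> \<one>\<^bsub>FA\<^esub> = f"
  using assms unfolding free_one_eq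
  by (induction rule: free_induct) (simp_all add: free_mult_monom free_l_distr)

lemma free_ring: "ring FA"
proof (rule ringI)
  show "abelian_group FA"
  proof (rule abelian_groupI)
    fix f assume f: "f \<in> carrier FA"
    \<comment> \<open>The scalar multiple by \<open>\<ominus> \<one>\<close> is the additive
      inverse; its support is finite by \<open>free_smult_closed\<close>.\<close>
    have "(\<ominus> \<one>) \<odot>\<^bsub>FA\<^esub> f \<oplus>\<^bsub>FA\<^esub> f = \<zero>\<^bsub>FA\<^esub>"
      using free_carrierD(1)[OF f] by (auto simp: free_algebra_def l_minus l_neg)
    then show "\<exists>g \<in> carrier FA. g \<oplus>\<^bsub>FA\<^esub> f = \<zero>\<^bsub>FA\<^esub>" using f by auto
  qed (use free_carrierD(1) in \<open>auto intro!: ext, auto simp: free_algebra_def a_ac\<close>)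
  show "monoid FA"
    by (rule monoidI) (simp_all add: free_m_assoc free_l_one free_r_one, simp add: free_one_eq)
qed (simp_all add: free_l_distr free_r_distr)

text \<open>A scalar \<open>c\<close> acts as multiplication by the term
  \<open>free_monom R c []\<close>, which is central. Compatibility of scalars with products then
  follows from associativity.\<close>

lemma free_assoc_algebra: "assoc_algebra R (FA :: ('a, 'x list \<Rightarrow> 'a) module)" (is "assoc_algebra R ?L")
proof -
  interpret L: ring ?L by (rule free_ring)
  have sm: "c \<odot>\<^bsub>?L\<^esub> f = free_monom R c [] \<otimes>\<^bsub>?L\<^esub> f" if "c \<in> carrier R" "f \<in> carrier ?L" for c f
    using that(2,1)
    by (induction rule: free_induct)
      (simp_all add: free_smult_monom free_mult_monom free_r_distr free_smult_r_distr)
  have ms: "f \<otimes>\<^bsub>?L\<^esub> free_monom R c [] = free_monom R c [] \<otimes>\<^bsub>?L\<^esub> f"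
    if "c \<in> carrier R" "f \<in> carrier ?L" for c f
    using that(2,1)
    by (induction rule: free_induct)
      (simp_all add: free_mult_monom free_r_distr free_l_distr m_comm)
  have "Module.module R ?L"
  proof (rule moduleI)
    show "cring R" by (rule is_cring)
    show "abelian_group ?L" by (rule L.is_abelian_group)
    fix c d f assume *: "c \<in> carrier R" "d \<in> carrier R" "f \<in> carrier ?L"
    show "(c \<oplus> d) \<odot>\<^bsub>?L\<^esub> f = c \<odot>\<^bsub>?L\<^esub> f \<oplus>\<^bsub>?L\<^esub> d \<odot>\<^bsub>?L\<^esub> f"
      using * free_carrierD(1) by (auto simp: free_algebra_def l_distr)
    show "(c \<otimes> d) \<odot>\<^bsub>?L\<^esub> f = c \<odot>\<^bsub>?L\<^esub> (d \<odot>\<^bsub>?L\<^esub> f)"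
      using * free_carrierD(1) by (auto simp: free_algebra_def m_assoc)
  next
    fix f assume "f \<in> carrier ?L"
    then show "\<one> \<odot>\<^bsub>?L\<^esub> f = f"
      using free_carrierD(1)[of f] by (simp add: free_algebra_def)
  qed (simp_all add: free_smult_r_distr)
  moreover have "assoc_algebra_axioms R ?L"
  proof
    fix c and x y :: "'x list \<Rightarrow> 'a" assume *: "c \<in> carrier R" "x \<in> carrier ?L" "y \<in> carrier ?L"
    show "c \<odot>\<^bsub>?L\<^esub> x \<otimes>\<^bsub>?L\<^esub> y = c \<odot>\<^bsub>?L\<^esub> (x \<otimes>\<^bsub>?L\<^esub> y)"
      using * by (simp add: sm L.m_assoc)
    show "x \<otimes>\<^bsub>?L\<^esub> (c \<odot>\<^bsub>?L\<^esub> y) = c \<odot>\<^bsub>?L\<^esub> (x \<otimes>\<^bsub>?L\<^esub> y)"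
      using * by (simp add: sm ms flip: L.m_assoc)
  qed
  ultimately show ?thesis by (simp add: assoc_algebra_def free_ring)
qed

text \<open>A word is the product of its letters, so agreement on generators passes to words, then
  to terms by scalars and to all elements by sums.\<close>

lemma free_alg_hom_unique:
  assumes h: "h \<in> alg_hom R FA B" and k: "k \<in> alg_hom R FA B"
    and gen: "\<And>x. h (free_gen R x) = k (free_gen R x)" and f: "f \<in> carrier FA"
  shows "h f = k f"
  using f
proof (induction rule: free_induct)
  case (monom c w)
  have "h (free_monom R \<one> w) = k (free_monom R \<one> w)"
  proof (induction w)
    case Nil
    show ?case using h k by (auto simp: alg_hom_def dest!: ring_hom_one simp flip: free_one_eq)
  next
    case (Cons x w)
    have "free_monom R \<one> (x # w) = free_gen R x \<otimes>\<^bsub>FA\<^esub> free_monom R \<one> w"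
      by (simp add: free_gen_eq free_mult_monom)
    then show ?case using h k gen[of x] Cons
      by (simp add: alg_hom_def ring_hom_def free_gen_eq)
  qed
  moreover have "free_monom R c w = c \<odot>\<^bsub>FA\<^esub> free_monom R \<one> w"
    using monom by (simp add: free_smult_monom)
  ultimately show ?case using h k monom by (simp add: alg_hom_def)
next
  case (add f g)
  then show ?case using h k by (simp add: alg_hom_def ring_hom_def)
qed

end

lemma alg_hom_ring_hom_ring:
  "h \<in> alg_hom F A B \<Longrightarrow> ring A \<Longrightarrow> ring B \<Longrightarrow> ring_hom_ring A B h"
  by (simp add: alg_hom_def ring_hom_ringI2)

lemma alg_hom_smult:
  "h \<in> alg_hom F A B \<Longrightarrow> c \<in> carrier F \<Longrightarrow> x \<in> carrier A \<Longrightarrow> h (c \<odot>\<^bsub>A\<^esub> x) = c \<odot>\<^bsub>B\<^esub> h x"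
  by (simp add: alg_hom_def)

lemma (in ring_hom_ring) hom_minus:
  "x \<in> carrier R \<Longrightarrow> y \<in> carrier R \<Longrightarrow> h (x \<ominus>\<^bsub>R\<^esub> y) = h x \<ominus>\<^bsub>S\<^esub> h y"
  by (simp add: R.minus_eq S.minus_eq)

section \<open>Evaluation of the free algebra, and quotients by ideals\<close>

context assoc_algebra
begin

definition word_eval :: "('x \<Rightarrow> 'c) \<Rightarrow> 'x list \<Rightarrow> 'c" where
  "word_eval v w = foldr (\<lambda>x y. v x \<otimes>\<^bsub>A\<^esub> y) w \<one>\<^bsub>A\<^esub>"

definition free_eval :: "('x \<Rightarrow> 'c) \<Rightarrow> ('x list \<Rightarrow> 'a) \<Rightarrow> 'c" where
  "free_eval v f = (\<Oplus>\<^bsub>A\<^esub>w\<in>{w. f w \<noteq> \<zero>}. f w \<odot>\<^bsub>A\<^esub> word_eval v w)"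

lemma word_eval_closed [simp]:
  "(\<And>x. v x \<in> carrier A) \<Longrightarrow> word_eval v w \<in> carrier A"
  by (induction w) (simp_all add: word_eval_def)

lemma word_eval_append:
  "(\<And>x. v x \<in> carrier A) \<Longrightarrow> word_eval v (u @ w) = word_eval v u \<otimes>\<^bsub>A\<^esub> word_eval v w"
proof (induction u)
  case (Cons x u)
  then show ?case using word_eval_closed[of v u] word_eval_closed[of v w]
    by (simp add: word_eval_def A.m_assoc)
qed (use word_eval_closed[of v w] in \<open>simp add: word_eval_def\<close>)

text \<open>Words outside the support contribute zero. This allows the sums for \<open>f\<close>,
  \<open>g\<close> and their sum, whose supports differ, to run over one index set.\<close>

lemma free_eval_superset:
  assumes v: "\<And>x. v x \<in> carrier A" and f: "f \<in> carrier FA"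
    and S: "finite S" "{w. f w \<noteq> \<zero>} \<subseteq> S"
  shows "free_eval v f = (\<Oplus>\<^bsub>A\<^esub>w\<in>S. f w \<odot>\<^bsub>A\<^esub> word_eval v w)"
  unfolding free_eval_def using S v free_carrierD(1)[OF f]
  by (intro M.add.finprod_mono_neutral_cong_left) auto

lemma free_eval_closed [simp]:
  assumes "\<And>x. v x \<in> carrier A" "f \<in> carrier FA"
  shows "free_eval v f \<in> carrier A"
  unfolding free_eval_def using assms free_carrierD(1)[OF assms(2)]
  by (intro M.finsum_closed) auto

lemma free_eval_monom:
  assumes v: "\<And>x. v x \<in> carrier A" and c: "c \<in> carrier F"
  shows "free_eval v (free_monom F c w) = c \<odot>\<^bsub>A\<^esub> word_eval v w"
proof -
  have "{u. free_monom F c w u \<noteq> \<zero>} \<subseteq> {w}" by (auto simp: free_monom_def)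
  then have "free_eval v (free_monom F c w) =
      (\<Oplus>\<^bsub>A\<^esub>u\<in>{w}. free_monom F c w u \<odot>\<^bsub>A\<^esub> word_eval v u)"
    using assms by (intro free_eval_superset) simp_all
  then show ?thesis using assms by (simp add: free_monom_def)
qed

lemma free_eval_add:
  assumes v: "\<And>x. v x \<in> carrier A" and f: "f \<in> carrier FA" and g: "g \<in> carrier FA"
  shows "free_eval v (f \<oplus>\<^bsub>FA\<^esub> g) = free_eval v f \<oplus>\<^bsub>A\<^esub> free_eval v g"
proof -
  let ?S = "{w. f w \<noteq> \<zero>} \<union> {w. g w \<noteq> \<zero>}"
  have fin: "finite ?S" using f g free_carrierD(2) by blast
  have fg: "(f \<oplus>\<^bsub>FA\<^esub> g) w = f w \<oplus> g w" for w by (simp add: free_algebra_def)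
  have "free_eval v (f \<oplus>\<^bsub>FA\<^esub> g) = (\<Oplus>\<^bsub>A\<^esub>w\<in>?S. (f w \<oplus> g w) \<odot>\<^bsub>A\<^esub> word_eval v w)"
    using f g fin v by (subst free_eval_superset[where S = ?S]) (auto simp: fg)
  also have "\<dots> = (\<Oplus>\<^bsub>A\<^esub>w\<in>?S. f w \<odot>\<^bsub>A\<^esub> word_eval v w \<oplus>\<^bsub>A\<^esub> g w \<odot>\<^bsub>A\<^esub> word_eval v w)"
    using v free_carrierD(1)[OF f] free_carrierD(1)[OF g]
    by (intro M.finsum_cong') (auto simp: smult_l_distr)
  also have "\<dots> = (\<Oplus>\<^bsub>A\<^esub>w\<in>?S. f w \<odot>\<^bsub>A\<^esub> word_eval v w) \<oplus>\<^bsub>A\<^esub> (\<Oplus>\<^bsub>A\<^esub>w\<in>?S. g w \<odot>\<^bsub>A\<^esub> word_eval v w)"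
    using v free_carrierD(1)[OF f] free_carrierD(1)[OF g] by (intro M.finsum_addf) auto
  also have "\<dots> = free_eval v f \<oplus>\<^bsub>A\<^esub> free_eval v g"
    using f g fin v by (simp add: free_eval_superset[where S = ?S])
  finally show ?thesis .
qed

lemma smult_mult_smult:
  assumes "c \<in> carrier F" "d \<in> carrier F" "x \<in> carrier A" "y \<in> carrier A"
  shows "(c \<odot>\<^bsub>A\<^esub> x) \<otimes>\<^bsub>A\<^esub> (d \<odot>\<^bsub>A\<^esub> y) = (c \<otimes> d) \<odot>\<^bsub>A\<^esub> (x \<otimes>\<^bsub>A\<^esub> y)"
  using assms by (simp add: smult_mult_left smult_mult_right R.m_comm flip: smult_assoc1)

text \<open>Biadditivity reduces the claim to terms, where \<open>word_eval\<close> turns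
  concatenation into multiplication and scalars move past algebra elements.\<close>

lemma free_eval_mult:
  assumes v: "\<And>x. v x \<in> carrier A" and f: "f \<in> carrier FA" and g: "g \<in> carrier FA"
  shows "free_eval v (f \<otimes>\<^bsub>FA\<^esub> g) = free_eval v f \<otimes>\<^bsub>A\<^esub> free_eval v g"
  using f g
proof (induction f rule: free_induct)
  case (monom c u)
  from monom(2,1) show ?case
  proof (induction g rule: free_induct)
    case (monom d w)
    then show ?case using v
      by (simp add: free_mult_monom free_eval_monom word_eval_append smult_mult_smult)
  next
    case (add g h)
    then show ?case using v
      by (simp add: free_r_distr free_eval_add A.r_distr)
  qed
next
  case (add f h)
  then show ?case using v
    by (simp add: free_l_distr free_eval_add A.l_distr)
qed

lemma free_eval_smult:
  assumes v: "\<And>x. v x \<in> carrier A" and c: "c \<in> carrier F" and f: "f \<in> carrier FA"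
  shows "free_eval v (c \<odot>\<^bsub>FA\<^esub> f) = c \<odot>\<^bsub>A\<^esub> free_eval v f"
  using f
proof (induction f rule: free_induct)
  case (monom d u)
  then show ?case using v c by (simp add: free_smult_monom free_eval_monom smult_assoc1)
next
  case (add f h)
  then show ?case using v c by (simp add: free_smult_r_distr free_eval_add smult_r_distr)
qed

lemma free_eval_alg_hom:
  assumes "\<And>x. v x \<in> carrier A"
  shows "free_eval v \<in> alg_hom F FA A"
proof -
  have "free_eval v \<one>\<^bsub>FA\<^esub> = \<one>\<^bsub>A\<^esub>"
    using assms by (simp add: free_one_eq free_eval_monom word_eval_def smult_one)
  then show ?thesis using assms
    by (simp add: alg_hom_def ring_hom_def free_eval_add free_eval_mult free_eval_smult)
qed

lemma free_eval_gen:
  "(\<And>x. v x \<in> carrier A) \<Longrightarrow> free_eval v (free_gen F x) = v x"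
  by (simp add: free_gen_eq free_eval_monom word_eval_def smult_one)

text \<open>Scalars act through the unit, \<open>c x = (c 1) x\<close>, so a two-sided ring ideal is
  already a subspace.\<close>

lemma ideal_smult_closed:
  assumes I: "ideal I A" and c: "c \<in> carrier F" and x: "x \<in> I"
  shows "c \<odot>\<^bsub>A\<^esub> x \<in> I"
proof -
  have xA: "x \<in> carrier A" using ideal.Icarr[OF I x] .
  then have "c \<odot>\<^bsub>A\<^esub> x = (c \<odot>\<^bsub>A\<^esub> \<one>\<^bsub>A\<^esub>) \<otimes>\<^bsub>A\<^esub> x" using c by (simp add: smult_mult_left)
  then show ?thesis using ideal.I_l_closed[OF I x, of "c \<odot>\<^bsub>A\<^esub> \<one>\<^bsub>A\<^esub>"] c by simp
qed

text \<open>Representatives of a coset differ by elements of \<open>I\<close>, whose scalar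
  multiples stay in \<open>I\<close>. Hence the union in \<open>quotient_algebra\<close> has all its
  members equal and collapses to one coset.\<close>

lemma quotient_smult:
  assumes I: "ideal I A" and c: "c \<in> carrier F" and x: "x \<in> carrier A"
  shows "c \<odot>\<^bsub>quotient_algebra A I\<^esub> (I +>\<^bsub>A\<^esub> x) = I +>\<^bsub>A\<^esub> (c \<odot>\<^bsub>A\<^esub> x)"
proof -
  interpret I: ideal I A by (rule I)
  have "I +>\<^bsub>A\<^esub> (c \<odot>\<^bsub>A\<^esub> y) = I +>\<^bsub>A\<^esub> (c \<odot>\<^bsub>A\<^esub> x)" if y: "y \<in> I +>\<^bsub>A\<^esub> x" for y
  proof -
    obtain h where h: "h \<in> I" "y = h \<oplus>\<^bsub>A\<^esub> x" using y unfolding a_r_coset_def' by auto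
    then have "c \<odot>\<^bsub>A\<^esub> y = c \<odot>\<^bsub>A\<^esub> h \<oplus>\<^bsub>A\<^esub> c \<odot>\<^bsub>A\<^esub> x" using c x by (simp add: smult_r_distr)
    then have "c \<odot>\<^bsub>A\<^esub> y \<in> I +>\<^bsub>A\<^esub> (c \<odot>\<^bsub>A\<^esub> x)"
      using ideal_smult_closed[OF I c h(1)] unfolding a_r_coset_def' by auto
    then show ?thesis using c x I.a_repr_independence' by simp
  qed
  then have "(\<Union>y \<in> I +>\<^bsub>A\<^esub> x. I +>\<^bsub>A\<^esub> (c \<odot>\<^bsub>A\<^esub> y)) = (\<Union>y \<in> I +>\<^bsub>A\<^esub> x. I +>\<^bsub>A\<^esub> (c \<odot>\<^bsub>A\<^esub> x))"
    by (rule SUP_cong[OF refl])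
  also have "\<dots> = I +>\<^bsub>A\<^esub> (c \<odot>\<^bsub>A\<^esub> x)" using I.a_rcos_self[OF x] by blast
  finally show ?thesis by (simp add: quotient_algebra_def)
qed

lemma quotient_carrierE:
  assumes "X \<in> carrier (quotient_algebra A I)"
  obtains x where "x \<in> carrier A" "X = I +>\<^bsub>A\<^esub> x"
  using assms by (auto simp: quotient_algebra_def FactRing_def A_RCOSETS_def')

lemma quotient_ring:
  assumes I: "ideal I A"
  shows "ring (quotient_algebra A I)" (is "ring ?Q")
proof -
  interpret Q: ring "A Quot I" using I by (rule ideal.quotient_is_ring)
  have eq: "carrier ?Q = carrier (A Quot I)" "monoid.mult ?Q = monoid.mult (A Quot I)" "one ?Q = one (A Quot I)"
    "zero ?Q = zero (A Quot I)" "add ?Q = add (A Quot I)"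
    by (simp_all add: quotient_algebra_def)
  show ?thesis
    by (intro ringI abelian_groupI monoidI; simp only: eq)
      (auto simp: Q.m_assoc Q.l_distr Q.r_distr Q.a_ac intro: Q.l_neg Q.a_inv_closed)
qed

lemma quotient_proj_alg_hom:
  assumes I: "ideal I A"
  shows "(+>\<^bsub>A\<^esub>) I \<in> alg_hom F A (quotient_algebra A I)"
  using ideal.rcos_ring_hom[OF I] quotient_smult[OF I]
  by (auto simp: alg_hom_def ring_hom_def quotient_algebra_def)

text \<open>Every coset has a representative and the projection respects all operations, so each
  axiom descends from \<open>A\<close>.\<close>

lemma quotient_assoc_algebra:
  assumes I: "ideal I A"
  shows "assoc_algebra F (quotient_algebra A I)" (is "assoc_algebra F ?Q")
proof -
  interpret Q: ring ?Q using I by (rule quotient_ring)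
  note h = quotient_proj_alg_hom[OF I]
  interpret h: ring_hom_ring A ?Q "(+>\<^bsub>A\<^esub>) I"
    using alg_hom_ring_hom_ring[OF h A.ring_axioms Q.ring_axioms] .
  note sm = alg_hom_smult[OF h, symmetric]
  have "Module.module F ?Q"
    by (intro moduleI R.is_cring Q.is_abelian_group; (elim quotient_carrierE)?)
      (simp_all add: sm smult_l_distr smult_r_distr smult_assoc1 smult_one
        flip: h.hom_add h.hom_mult)
  moreover have "assoc_algebra_axioms F ?Q"
    by (unfold_locales; elim quotient_carrierE)
      (simp_all add: sm smult_mult_left smult_mult_right flip: h.hom_mult)
  ultimately show ?thesis by (simp add: assoc_algebra_def Q.ring_axioms)
qed

lemma quotient_lift:
  assumes I: "ideal I A" and h: "h \<in> alg_hom F A B" and B: "ring B"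
    and ker: "\<And>x. x \<in> I \<Longrightarrow> h x = \<zero>\<^bsub>B\<^esub>"
  obtains g where "g \<in> alg_hom F (quotient_algebra A I) B"
    "\<And>x. x \<in> carrier A \<Longrightarrow> g (I +>\<^bsub>A\<^esub> x) = h x"
proof -
  let ?Q = "quotient_algebra A I"
  interpret I: ideal I A by (rule I)
  interpret Q: ring ?Q using I by (rule quotient_ring)
  interpret h: ring_hom_ring A B h
    using alg_hom_ring_hom_ring[OF h A.ring_axioms B] .
  interpret \<pi>: ring_hom_ring A ?Q "(+>\<^bsub>A\<^esub>) I"
    using alg_hom_ring_hom_ring[OF quotient_proj_alg_hom[OF I] A.ring_axioms Q.ring_axioms] .
  \<comment> \<open>Any representative gives the same value: two of them differ by an element of
    \<open>I\<close>, which \<open>h\<close> sends to zero.\<close>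
  define g where "g X = h (SOME x. x \<in> X)" for X
  have g: "g (I +>\<^bsub>A\<^esub> x) = h x" if x: "x \<in> carrier A" for x
  proof -
    have "(SOME y. y \<in> I +>\<^bsub>A\<^esub> x) \<in> I +>\<^bsub>A\<^esub> x" using I.a_rcos_self[OF x] by (rule someI)
    then obtain y where y: "y \<in> I" "(SOME y. y \<in> I +>\<^bsub>A\<^esub> x) = y \<oplus>\<^bsub>A\<^esub> x"
      unfolding a_r_coset_def' by auto
    have "g (I +>\<^bsub>A\<^esub> x) = h y \<oplus>\<^bsub>B\<^esub> h x"
      unfolding g_def y(2) using x I.Icarr[OF y(1)] by (rule h.hom_add[rotated])
    then show ?thesis using x by (simp add: ker[OF y(1)])
  qed
  have "g \<in> alg_hom F ?Q B"
    unfolding alg_hom_def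
  proof (intro CollectI conjI ring_hom_memI ballI)
    show "g \<one>\<^bsub>?Q\<^esub> = \<one>\<^bsub>B\<^esub>" by (simp add: g flip: \<pi>.hom_one)
  next
    fix X assume "X \<in> carrier ?Q"
    then obtain x where x: "x \<in> carrier A" "X = I +>\<^bsub>A\<^esub> x" by (rule quotient_carrierE)
    then show "g X \<in> carrier B" by (simp add: g)
    show "g (c \<odot>\<^bsub>?Q\<^esub> X) = c \<odot>\<^bsub>B\<^esub> g X" if "c \<in> carrier F" for c
      using that x by (simp add: g quotient_smult[OF I] alg_hom_smult[OF h])
    fix Y assume "Y \<in> carrier ?Q"
    then obtain y where y: "y \<in> carrier A" "Y = I +>\<^bsub>A\<^esub> y" by (rule quotient_carrierE)
    show "g (X \<otimes>\<^bsub>?Q\<^esub> Y) = g X \<otimes>\<^bsub>B\<^esub> g Y"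
      unfolding x(2) y(2) \<pi>.hom_mult[OF x(1) y(1), symmetric] using x(1) y(1)
      by (simp add: g del: \<pi>.hom_mult)
    show "g (X \<oplus>\<^bsub>?Q\<^esub> Y) = g X \<oplus>\<^bsub>B\<^esub> g Y"
      unfolding x(2) y(2) \<pi>.hom_add[OF x(1) y(1), symmetric] using x(1) y(1)
      by (simp add: g del: \<pi>.hom_add)
  qed
  with g that show thesis by blast
qed

end

section \<open>The presentation of the cyclic algebra\<close>

text \<open>By \<open>symbol_lift\<close> such pairs are the possible images of the generators
  \<open>i\<close>, \<open>j\<close> under homomorphisms from the symbol to \<open>A\<close>.
  Changes of generators are therefore changes of such pairs.\<close>

definition cyclic_pair ::
    "('a, 'm) ring_scheme \<Rightarrow> nat \<Rightarrow> ('a, 'b, 'k) module_scheme \<Rightarrow> 'a \<Rightarrow> 'a \<Rightarrow> 'b \<Rightarrow> 'b \<Rightarrow> bool" where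
  "cyclic_pair F p A \<alpha> \<beta> x y \<longleftrightarrow> x \<in> carrier A \<and> y \<in> carrier A \<and>
    x [^]\<^bsub>A\<^esub> p \<ominus>\<^bsub>A\<^esub> x = \<alpha> \<odot>\<^bsub>A\<^esub> \<one>\<^bsub>A\<^esub> \<and> y [^]\<^bsub>A\<^esub> p = \<beta> \<odot>\<^bsub>A\<^esub> \<one>\<^bsub>A\<^esub> \<and>
    y \<otimes>\<^bsub>A\<^esub> x = (x \<ominus>\<^bsub>A\<^esub> \<one>\<^bsub>A\<^esub>) \<otimes>\<^bsub>A\<^esub> y"

definition symbol_i where
  "symbol_i F p \<alpha> \<beta> =
    Idl\<^bsub>free_algebra F\<^esub> (cyclic_relators F p \<alpha> \<beta>) +>\<^bsub>free_algebra F\<^esub> free_gen F Gen_i"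

definition symbol_j where
  "symbol_j F p \<alpha> \<beta> =
    Idl\<^bsub>free_algebra F\<^esub> (cyclic_relators F p \<alpha> \<beta>) +>\<^bsub>free_algebra F\<^esub> free_gen F Gen_j"

locale symbol_algebra = cring F for F (structure) +
  fixes p :: nat and \<alpha> \<beta> :: 'a
  assumes \<alpha> [simp]: "\<alpha> \<in> carrier F" and \<beta> [simp]: "\<beta> \<in> carrier F"
begin

abbreviation L where "L \<equiv> free_algebra F :: ('a, cyclic_gen list \<Rightarrow> 'a) module"
abbreviation I where "I \<equiv> Idl\<^bsub>L\<^esub> (cyclic_relators F p \<alpha> \<beta>)"
abbreviation S where "S \<equiv> cyclic_symbol F p \<alpha> \<beta>"
abbreviation i where "i \<equiv> symbol_i F p \<alpha> \<beta>"
abbreviation j where "j \<equiv> symbol_j F p \<alpha> \<beta>"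

sublocale L: assoc_algebra F L by (rule free_assoc_algebra)

lemma gen_closed [simp]: "free_gen F x \<in> carrier FA"
  by (simp add: free_gen_eq)

lemma relators_closed: "cyclic_relators F p \<alpha> \<beta> \<subseteq> carrier L"
  by (simp add: cyclic_relators_def Let_def)

lemma relator_ideal: "ideal I L"
  using relators_closed by (rule L.A.genideal_ideal)

lemma assoc_algebra_symbol: "assoc_algebra F S"
  unfolding cyclic_symbol_def using relator_ideal by (rule L.quotient_assoc_algebra)

lemma proj_alg_hom: "(+>\<^bsub>L\<^esub>) I \<in> alg_hom F L S"
  unfolding cyclic_symbol_def using relator_ideal by (rule L.quotient_proj_alg_hom)

text \<open>Each relator is the difference of the two sides of a relation. Applied to the projection
  this yields the relations in the symbol; applied to an evaluation map it yields homomorphisms out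
  of the symbol.\<close>

lemma cyclic_pair_iff_relators:
  assumes A: "assoc_algebra F A" and h: "h \<in> alg_hom F L A"
  shows "cyclic_pair F p A \<alpha> \<beta> (h (free_gen F Gen_i)) (h (free_gen F Gen_j)) \<longleftrightarrow>
    (\<forall>r \<in> cyclic_relators F p \<alpha> \<beta>. h r = \<zero>\<^bsub>A\<^esub>)"
proof -
  interpret A: assoc_algebra F A by (rule A)
  interpret h: ring_hom_ring L A h
    using alg_hom_ring_hom_ring[OF h L.A.ring_axioms A.A.ring_axioms] .
  show ?thesis
    by (simp add: cyclic_relators_def cyclic_pair_def Let_def h.hom_minus h.hom_nat_pow
        alg_hom_smult[OF h] A.A.r_right_minus_eq)
qed

lemma cyclic_pair_symbol: "cyclic_pair F p S \<alpha> \<beta> i j"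
proof -
  have "I +>\<^bsub>L\<^esub> r = \<zero>\<^bsub>S\<^esub>" if "r \<in> cyclic_relators F p \<alpha> \<beta>" for r
  proof -
    have "r \<in> I" using that L.A.genideal_self[OF relators_closed] by blast
    then have "I +>\<^bsub>L\<^esub> r = I" using relator_ideal by (intro L.A.a_rcos_zero)
    then show ?thesis by (simp add: cyclic_symbol_def quotient_algebra_def FactRing_def)
  qed
  then show ?thesis
    using cyclic_pair_iff_relators[OF assoc_algebra_symbol proj_alg_hom]
    by (simp add: symbol_i_def symbol_j_def)
qed

text \<open>Evaluating words at \<open>x\<close> and \<open>y\<close> kills the relators. The kernel
  is an ideal, so it contains \<open>I\<close>, and the evaluation factors through the
  quotient.\<close>

lemma symbol_lift:
  assumes A: "assoc_algebra F A" and xy: "cyclic_pair F p A \<alpha> \<beta> x y"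
  obtains g where "g \<in> alg_hom F S A" "g i = x" "g j = y"
proof -
  interpret A: assoc_algebra F A by (rule A)
  define v where "v = case_cyclic_gen x y"
  have v: "v z \<in> carrier A" for z
    using xy by (cases z) (auto simp: v_def cyclic_pair_def)
  let ?h = "A.free_eval v"
  have h: "?h \<in> alg_hom F L A" using v by (rule A.free_eval_alg_hom)
  interpret h: ring_hom_ring L A ?h
    using alg_hom_ring_hom_ring[OF h L.A.ring_axioms A.A.ring_axioms] .
  have gen: "?h (free_gen F Gen_i) = x" "?h (free_gen F Gen_j) = y"
    using v A.free_eval_gen[of v] by (simp_all add: v_def[THEN fun_cong])
  have "\<forall>r \<in> cyclic_relators F p \<alpha> \<beta>. ?h r = \<zero>\<^bsub>A\<^esub>"
    using cyclic_pair_iff_relators[OF A h] xy unfolding gen by (rule iffD1)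
  then have "cyclic_relators F p \<alpha> \<beta> \<subseteq> a_kernel L A ?h"
    using relators_closed unfolding a_kernel_def' by blast
  then have "I \<subseteq> a_kernel L A ?h"
    by (intro L.A.genideal_minimal h.kernel_is_ideal)
  then have "\<And>r. r \<in> I \<Longrightarrow> ?h r = \<zero>\<^bsub>A\<^esub>"
    unfolding a_kernel_def' by blast
  then obtain g where "g \<in> alg_hom F S A" "\<And>f. f \<in> carrier L \<Longrightarrow> g (I +>\<^bsub>L\<^esub> f) = ?h f"
    unfolding cyclic_symbol_def
    using L.quotient_lift[OF relator_ideal h A.A.ring_axioms] by metis
  with that gen show thesis by (simp add: symbol_i_def symbol_j_def)
qed

lemma symbol_hom_unique:
  assumes g: "g \<in> alg_hom F S A" and h: "h \<in> alg_hom F S A"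
    and "g i = h i" "g j = h j" and x: "x \<in> carrier S"
  shows "g x = h x"
proof -
  obtain f where f: "f \<in> carrier L" "x = I +>\<^bsub>L\<^esub> f"
    using x unfolding cyclic_symbol_def by (rule L.quotient_carrierE)
  have "(g \<circ> (+>\<^bsub>L\<^esub>) I) (free_gen F z) = (h \<circ> (+>\<^bsub>L\<^esub>) I) (free_gen F z)" for z
    using assms(3,4) by (cases z) (simp_all add: symbol_i_def symbol_j_def)
  then have "(g \<circ> (+>\<^bsub>L\<^esub>) I) f = (h \<circ> (+>\<^bsub>L\<^esub>) I) f"
    by (intro free_alg_hom_unique[OF alg_hom_comp[OF proj_alg_hom g] alg_hom_comp[OF proj_alg_hom h] _ f(1)])
  then show ?thesis by (simp add: f)
qed

end

section \<open>Changing the generators\<close>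

context assoc_algebra
begin

lemma add_pow_one_smult: "[n] \<cdot>\<^bsub>A\<^esub> \<one>\<^bsub>A\<^esub> = ([n] \<cdot> \<one>) \<odot>\<^bsub>A\<^esub> \<one>\<^bsub>A\<^esub>" for n :: nat
  by (induction n) (simp_all add: smult_l_distr smult_one)

lemma smult_pow:
  assumes "c \<in> carrier F" "x \<in> carrier A"
  shows "(c \<odot>\<^bsub>A\<^esub> x) [^]\<^bsub>A\<^esub> (n::nat) = (c [^] n) \<odot>\<^bsub>A\<^esub> (x [^]\<^bsub>A\<^esub> n)"
  using assms by (induction n) (simp_all add: smult_mult_smult smult_one)

lemma smult_one_mult:
  assumes "c \<in> carrier F" "x \<in> carrier A"
  shows "(c \<odot>\<^bsub>A\<^esub> \<one>\<^bsub>A\<^esub>) \<otimes>\<^bsub>A\<^esub> x = c \<odot>\<^bsub>A\<^esub> x" "x \<otimes>\<^bsub>A\<^esub> (c \<odot>\<^bsub>A\<^esub> \<one>\<^bsub>A\<^esub>) = c \<odot>\<^bsub>A\<^esub> x"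
  using assms by (simp_all add: smult_mult_left smult_mult_right)

lemma smult_left_cancel:
  assumes "field F" "c \<in> carrier F" "c \<noteq> \<zero>" "x \<in> carrier A" "y \<in> carrier A"
    and eq: "c \<odot>\<^bsub>A\<^esub> x = c \<odot>\<^bsub>A\<^esub> y"
  shows "x = y"
proof -
  interpret field F by fact
  have c: "inv c \<in> carrier F" "inv c \<otimes> c = \<one>"
    using assms(2,3) by (simp_all add: field_Units)
  have "z = inv c \<odot>\<^bsub>A\<^esub> (c \<odot>\<^bsub>A\<^esub> z)" if "z \<in> carrier A" for z
    using smult_assoc1[of "inv c" c z] that assms(2) c by (simp add: smult_one)
  then show ?thesis using assms(4-6) by metis
qed

end

locale char_p_algebra = assoc_algebra F A + F?: field F for F (structure) and A (structure) +
  fixes p :: nat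
  assumes prime: "prime p" and char: "[p] \<cdot>\<^bsub>F\<^esub> \<one>\<^bsub>F\<^esub> = \<zero>\<^bsub>F\<^esub>"
begin

lemma char_A: "[p] \<cdot>\<^bsub>A\<^esub> \<one>\<^bsub>A\<^esub> = \<zero>\<^bsub>A\<^esub>"
  by (simp add: add_pow_one_smult char)

lemma frobenius_add_smult_one:
  assumes "x \<in> carrier A" "c \<in> carrier F"
  shows "(x \<oplus>\<^bsub>A\<^esub> c \<odot>\<^bsub>A\<^esub> \<one>\<^bsub>A\<^esub>) [^]\<^bsub>A\<^esub> p = x [^]\<^bsub>A\<^esub> p \<oplus>\<^bsub>A\<^esub> (c [^] p) \<odot>\<^bsub>A\<^esub> \<one>\<^bsub>A\<^esub>"
  using assms A.frobenius_add[OF prime char_A, of x "c \<odot>\<^bsub>A\<^esub> \<one>\<^bsub>A\<^esub>"]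
  by (simp add: smult_one_mult smult_pow)

text \<open>The shift identity \<open>(x y)^p = (x^p - x) y^p\<close>, with both factors on the
  right replaced by scalars.\<close>

lemma cyclic_pair_mult_pow:
  assumes "cyclic_pair F p A \<alpha> \<beta> x y" "\<alpha> \<in> carrier F" "\<beta> \<in> carrier F"
  shows "(x \<otimes>\<^bsub>A\<^esub> y) [^]\<^bsub>A\<^esub> p = (\<alpha> \<otimes> \<beta>) \<odot>\<^bsub>A\<^esub> \<one>\<^bsub>A\<^esub>"
  using assms A.shift_commute_mult_pow_char[OF prime char_A, of x y]
  by (simp add: cyclic_pair_def smult_mult_smult)

text \<open>The element \<open>d\<close> times the unit is central: Frobenius is additive on the
  sum, so \<open>x^p - x\<close> changes by \<open>d^p - d\<close>, and the commutation relation
  with \<open>y\<close> persists.\<close>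

lemma cyclic_pair_shift:
  assumes xy: "cyclic_pair F p A \<alpha> \<beta> x y" and \<alpha>: "\<alpha> \<in> carrier F" and d: "d \<in> carrier F"
  shows "cyclic_pair F p A (\<alpha> \<oplus> (d [^] p \<ominus> d)) \<beta> (x \<oplus>\<^bsub>A\<^esub> d \<odot>\<^bsub>A\<^esub> \<one>\<^bsub>A\<^esub>) y"
proof -
  have c: "x \<in> carrier A" "y \<in> carrier A" using xy by (simp_all add: cyclic_pair_def)
  have "(x \<oplus>\<^bsub>A\<^esub> d \<odot>\<^bsub>A\<^esub> \<one>\<^bsub>A\<^esub>) [^]\<^bsub>A\<^esub> p \<ominus>\<^bsub>A\<^esub> (x \<oplus>\<^bsub>A\<^esub> d \<odot>\<^bsub>A\<^esub> \<one>\<^bsub>A\<^esub>) =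
      (x [^]\<^bsub>A\<^esub> p \<ominus>\<^bsub>A\<^esub> x) \<oplus>\<^bsub>A\<^esub> ((d [^] p) \<odot>\<^bsub>A\<^esub> \<one>\<^bsub>A\<^esub> \<ominus>\<^bsub>A\<^esub> d \<odot>\<^bsub>A\<^esub> \<one>\<^bsub>A\<^esub>)"
    using c d by (simp add: frobenius_add_smult_one M.minus_eq M.minus_add M.a_ac)
  also have "\<dots> = (\<alpha> \<oplus> (d [^] p \<ominus> d)) \<odot>\<^bsub>A\<^esub> \<one>\<^bsub>A\<^esub>"
    using xy \<alpha> d by (simp add: cyclic_pair_def smult_l_distr smult_l_minus M.minus_eq R.minus_eq)
  moreover have "y \<otimes>\<^bsub>A\<^esub> (x \<oplus>\<^bsub>A\<^esub> d \<odot>\<^bsub>A\<^esub> \<one>\<^bsub>A\<^esub>) = (x \<oplus>\<^bsub>A\<^esub> d \<odot>\<^bsub>A\<^esub> \<one>\<^bsub>A\<^esub> \<ominus>\<^bsub>A\<^esub> \<one>\<^bsub>A\<^esub>) \<otimes>\<^bsub>A\<^esub> y"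
  proof -
    have "y \<otimes>\<^bsub>A\<^esub> (x \<oplus>\<^bsub>A\<^esub> d \<odot>\<^bsub>A\<^esub> \<one>\<^bsub>A\<^esub>) = (x \<ominus>\<^bsub>A\<^esub> \<one>\<^bsub>A\<^esub>) \<otimes>\<^bsub>A\<^esub> y \<oplus>\<^bsub>A\<^esub> (d \<odot>\<^bsub>A\<^esub> \<one>\<^bsub>A\<^esub>) \<otimes>\<^bsub>A\<^esub> y"
      using xy d by (simp add: cyclic_pair_def A.r_distr smult_one_mult)
    also have "\<dots> = (x \<oplus>\<^bsub>A\<^esub> d \<odot>\<^bsub>A\<^esub> \<one>\<^bsub>A\<^esub> \<ominus>\<^bsub>A\<^esub> \<one>\<^bsub>A\<^esub>) \<otimes>\<^bsub>A\<^esub> y"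
      using c d by (simp add: M.minus_eq M.a_ac flip: A.l_distr)
    finally show ?thesis .
  qed
  ultimately show ?thesis using xy c d by (simp add: cyclic_pair_def)
qed

text \<open>With \<open>x' = x + e y\<^sup>p\<^sup>-\<^sup>1\<close> one has \<open>x' y = x y + e \<beta>\<close>, a sum of commuting elements, so
  \<open>(x'\<^sup>p - x') \<beta> = (x' y)\<^sup>p = \<alpha> \<beta> + (e \<beta>)\<^sup>p\<close>.\<close>

lemma cyclic_pair_add_power:
  assumes xy: "cyclic_pair F p A \<alpha> \<beta> x y"
    and F: "\<alpha> \<in> carrier F" "\<beta> \<in> carrier F" "\<beta> \<noteq> \<zero>" "e \<in> carrier F" "\<alpha>' \<in> carrier F"
    and \<alpha>': "\<alpha>' \<otimes> \<beta> = \<alpha> \<otimes> \<beta> \<oplus> (e \<otimes> \<beta>) [^] p"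
  shows "cyclic_pair F p A \<alpha>' \<beta> (x \<oplus>\<^bsub>A\<^esub> e \<odot>\<^bsub>A\<^esub> y [^]\<^bsub>A\<^esub> (p - 1)) y"
proof -
  define q where "q = y [^]\<^bsub>A\<^esub> (p - 1)"
  let ?x = "x \<oplus>\<^bsub>A\<^esub> e \<odot>\<^bsub>A\<^esub> q"
  have c: "x \<in> carrier A" "y \<in> carrier A" "?x \<in> carrier A" and qc: "q \<in> carrier A"
    using xy F by (simp_all add: cyclic_pair_def q_def)
  have "p = Suc (p - 1)" using prime prime_gt_0_nat by simp
  \<comment> \<open>Thus \<open>q\<close> is \<open>\<beta>\<close> times the inverse of
    \<open>y\<close>. Since it commutes with \<open>y\<close>, adding a multiple of it to
    \<open>x\<close> preserves the commutation relation, and the shift identity applies to the new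
    pair.\<close>
  then have qy: "q \<otimes>\<^bsub>A\<^esub> y = \<beta> \<odot>\<^bsub>A\<^esub> \<one>\<^bsub>A\<^esub>" "y \<otimes>\<^bsub>A\<^esub> q = \<beta> \<odot>\<^bsub>A\<^esub> \<one>\<^bsub>A\<^esub>"
    unfolding q_def using xy c by (metis cyclic_pair_def A.nat_pow_Suc, metis cyclic_pair_def A.nat_pow_Suc2)
  have "y \<otimes>\<^bsub>A\<^esub> ?x = (x \<ominus>\<^bsub>A\<^esub> \<one>\<^bsub>A\<^esub>) \<otimes>\<^bsub>A\<^esub> y \<oplus>\<^bsub>A\<^esub> (e \<odot>\<^bsub>A\<^esub> q) \<otimes>\<^bsub>A\<^esub> y"
    using xy F c qc by (simp add: cyclic_pair_def A.r_distr smult_mult_left smult_mult_right qc qy)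
  also have "\<dots> = (?x \<ominus>\<^bsub>A\<^esub> \<one>\<^bsub>A\<^esub>) \<otimes>\<^bsub>A\<^esub> y"
    using c qc F by (simp add: M.minus_eq M.a_ac flip: A.l_distr)
  finally have comm: "y \<otimes>\<^bsub>A\<^esub> ?x = (?x \<ominus>\<^bsub>A\<^esub> \<one>\<^bsub>A\<^esub>) \<otimes>\<^bsub>A\<^esub> y" .
  have "?x \<otimes>\<^bsub>A\<^esub> y = x \<otimes>\<^bsub>A\<^esub> y \<oplus>\<^bsub>A\<^esub> (e \<otimes> \<beta>) \<odot>\<^bsub>A\<^esub> \<one>\<^bsub>A\<^esub>"
    using c qc F by (simp add: A.l_distr smult_mult_left qc qy smult_assoc1)
  then have "(?x \<otimes>\<^bsub>A\<^esub> y) [^]\<^bsub>A\<^esub> p = \<beta> \<odot>\<^bsub>A\<^esub> (\<alpha>' \<odot>\<^bsub>A\<^esub> \<one>\<^bsub>A\<^esub>)"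
    using c qc F by (simp add: frobenius_add_smult_one cyclic_pair_mult_pow[OF xy] R.m_comm[of \<beta>]
        flip: smult_l_distr smult_assoc1 \<alpha>')
  moreover have "(?x \<otimes>\<^bsub>A\<^esub> y) [^]\<^bsub>A\<^esub> p = \<beta> \<odot>\<^bsub>A\<^esub> (?x [^]\<^bsub>A\<^esub> p \<ominus>\<^bsub>A\<^esub> ?x)"
    using A.shift_commute_mult_pow_char[OF prime char_A c(3,2) comm] xy c F
    by (simp add: cyclic_pair_def smult_one_mult)
  ultimately have eq: "\<beta> \<odot>\<^bsub>A\<^esub> (?x [^]\<^bsub>A\<^esub> p \<ominus>\<^bsub>A\<^esub> ?x) = \<beta> \<odot>\<^bsub>A\<^esub> (\<alpha>' \<odot>\<^bsub>A\<^esub> \<one>\<^bsub>A\<^esub>)"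
    by (rule trans[OF sym, rotated])
  have "?x [^]\<^bsub>A\<^esub> p \<ominus>\<^bsub>A\<^esub> ?x = \<alpha>' \<odot>\<^bsub>A\<^esub> \<one>\<^bsub>A\<^esub>"
    by (rule smult_left_cancel[OF F.field_axioms F(2,3) _ _ eq]) (use c F in simp_all)
  with comm c xy show ?thesis by (simp add: cyclic_pair_def q_def)
qed

text \<open>Since \<open>x\<close> commutes with \<open>x - 1\<close>, the factor \<open>x\<close>
  in front of \<open>y\<close> does not disturb the commutation relation; the power comes from
  \<open>cyclic_pair_mult_pow\<close>.\<close>

lemma cyclic_pair_mult_left:
  assumes xy: "cyclic_pair F p A \<alpha> \<beta> x y" and F: "\<alpha> \<in> carrier F" "\<beta> \<in> carrier F"
  shows "cyclic_pair F p A \<alpha> (\<alpha> \<otimes> \<beta>) x (x \<otimes>\<^bsub>A\<^esub> y)"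
proof -
  have c: "x \<in> carrier A" "y \<in> carrier A" "y \<otimes>\<^bsub>A\<^esub> x = (x \<ominus>\<^bsub>A\<^esub> \<one>\<^bsub>A\<^esub>) \<otimes>\<^bsub>A\<^esub> y"
    using xy by (simp_all add: cyclic_pair_def)
  have "x \<otimes>\<^bsub>A\<^esub> y \<otimes>\<^bsub>A\<^esub> x = x \<otimes>\<^bsub>A\<^esub> (x \<ominus>\<^bsub>A\<^esub> \<one>\<^bsub>A\<^esub>) \<otimes>\<^bsub>A\<^esub> y"
    using c by (simp add: A.m_assoc)
  also have "x \<otimes>\<^bsub>A\<^esub> (x \<ominus>\<^bsub>A\<^esub> \<one>\<^bsub>A\<^esub>) = (x \<ominus>\<^bsub>A\<^esub> \<one>\<^bsub>A\<^esub>) \<otimes>\<^bsub>A\<^esub> x"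
    using c(1) by (simp add: M.minus_eq A.l_distr A.r_distr A.l_minus A.r_minus)
  finally show ?thesis
    using c cyclic_pair_mult_pow[OF xy F] xy by (simp add: cyclic_pair_def A.m_assoc)
qed

text \<open>The elements \<open>x\<close> and \<open>z y\<close> have product \<open>y\<close>, so
  the shift identity gives \<open>y^p = \<alpha> (z y)^p\<close>, and \<open>\<alpha>\<close> can be
  cancelled. This undoes \<open>cyclic_pair_mult_left\<close>.\<close>

lemma cyclic_pair_mult_inverse:
  assumes xy: "cyclic_pair F p A \<alpha> (\<alpha> \<otimes> \<beta>) x y"
    and F: "\<alpha> \<in> carrier F" "\<beta> \<in> carrier F" "\<alpha> \<noteq> \<zero>"
    and z: "z \<in> carrier A" "x \<otimes>\<^bsub>A\<^esub> z = \<one>\<^bsub>A\<^esub>" "z \<otimes>\<^bsub>A\<^esub> x = \<one>\<^bsub>A\<^esub>"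
  shows "cyclic_pair F p A \<alpha> \<beta> x (z \<otimes>\<^bsub>A\<^esub> y)"
proof -
  have c: "x \<in> carrier A" "y \<in> carrier A" "y \<otimes>\<^bsub>A\<^esub> x = (x \<ominus>\<^bsub>A\<^esub> \<one>\<^bsub>A\<^esub>) \<otimes>\<^bsub>A\<^esub> y"
    using xy by (simp_all add: cyclic_pair_def)
  have "z \<otimes>\<^bsub>A\<^esub> y \<otimes>\<^bsub>A\<^esub> x = z \<otimes>\<^bsub>A\<^esub> (x \<ominus>\<^bsub>A\<^esub> \<one>\<^bsub>A\<^esub>) \<otimes>\<^bsub>A\<^esub> y"
    using c z(1) by (simp add: A.m_assoc)
  also have "z \<otimes>\<^bsub>A\<^esub> (x \<ominus>\<^bsub>A\<^esub> \<one>\<^bsub>A\<^esub>) = (x \<ominus>\<^bsub>A\<^esub> \<one>\<^bsub>A\<^esub>) \<otimes>\<^bsub>A\<^esub> z"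
    using c(1) z by (simp add: M.minus_eq A.l_distr A.r_distr A.l_minus A.r_minus)
  finally have comm: "z \<otimes>\<^bsub>A\<^esub> y \<otimes>\<^bsub>A\<^esub> x = (x \<ominus>\<^bsub>A\<^esub> \<one>\<^bsub>A\<^esub>) \<otimes>\<^bsub>A\<^esub> (z \<otimes>\<^bsub>A\<^esub> y)"
    using c(1,2) z(1) by (simp add: A.m_assoc)
  have "x \<otimes>\<^bsub>A\<^esub> (z \<otimes>\<^bsub>A\<^esub> y) = y" using c(1,2) z by (simp flip: A.m_assoc)
  then have "\<alpha> \<odot>\<^bsub>A\<^esub> ((z \<otimes>\<^bsub>A\<^esub> y) [^]\<^bsub>A\<^esub> p) = y [^]\<^bsub>A\<^esub> p"
    using A.shift_commute_mult_pow_char[OF prime char_A c(1) _ comm] xy c(2) z(1) F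
    by (simp add: cyclic_pair_def smult_one_mult)
  also have "\<dots> = \<alpha> \<odot>\<^bsub>A\<^esub> (\<beta> \<odot>\<^bsub>A\<^esub> \<one>\<^bsub>A\<^esub>)"
    using xy F by (simp add: cyclic_pair_def smult_assoc1)
  finally have eq: "\<alpha> \<odot>\<^bsub>A\<^esub> ((z \<otimes>\<^bsub>A\<^esub> y) [^]\<^bsub>A\<^esub> p) = \<alpha> \<odot>\<^bsub>A\<^esub> (\<beta> \<odot>\<^bsub>A\<^esub> \<one>\<^bsub>A\<^esub>)" .
  have "(z \<otimes>\<^bsub>A\<^esub> y) [^]\<^bsub>A\<^esub> p = \<beta> \<odot>\<^bsub>A\<^esub> \<one>\<^bsub>A\<^esub>"
    by (rule smult_left_cancel[OF F.field_axioms F(1,3) _ _ eq]) (use c z(1) F in simp_all)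
  with comm c(1,2) z(1) xy show ?thesis by (simp add: cyclic_pair_def)
qed

text \<open>The relation \<open>x (x^(p-1) - 1) = x^p - x = \<alpha>\<close> inverts
  \<open>x\<close>. The explicit formula makes the image of the inverse under a homomorphism
  computable.\<close>

lemma cyclic_pair_inverse:
  assumes xy: "cyclic_pair F p A \<alpha> \<beta> x y" and F: "\<alpha> \<in> carrier F" "\<alpha> \<noteq> \<zero>"
  defines "z \<equiv> inv \<alpha> \<odot>\<^bsub>A\<^esub> (x [^]\<^bsub>A\<^esub> (p - 1) \<ominus>\<^bsub>A\<^esub> \<one>\<^bsub>A\<^esub>)"
  shows "z \<in> carrier A" "x \<otimes>\<^bsub>A\<^esub> z = \<one>\<^bsub>A\<^esub>" "z \<otimes>\<^bsub>A\<^esub> x = \<one>\<^bsub>A\<^esub>"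
proof -
  have c: "x \<in> carrier A" using xy by (simp add: cyclic_pair_def)
  have inv: "inv \<alpha> \<in> carrier F" "inv \<alpha> \<otimes> \<alpha> = \<one>" using F by (simp_all add: F.field_Units)
  have "p = Suc (p - 1)" using prime prime_gt_0_nat by simp
  then have q: "x [^]\<^bsub>A\<^esub> (p - 1) \<otimes>\<^bsub>A\<^esub> x = x [^]\<^bsub>A\<^esub> p" "x \<otimes>\<^bsub>A\<^esub> x [^]\<^bsub>A\<^esub> (p - 1) = x [^]\<^bsub>A\<^esub> p"
    using c by (metis A.nat_pow_Suc, metis A.nat_pow_Suc2)
  have eq: "inv \<alpha> \<odot>\<^bsub>A\<^esub> (x [^]\<^bsub>A\<^esub> p \<ominus>\<^bsub>A\<^esub> x) = \<one>\<^bsub>A\<^esub>"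
    using xy F inv by (simp add: cyclic_pair_def smult_one flip: smult_assoc1)
  show "z \<in> carrier A" using c inv by (simp add: z_def)
  show "x \<otimes>\<^bsub>A\<^esub> z = \<one>\<^bsub>A\<^esub>" "z \<otimes>\<^bsub>A\<^esub> x = \<one>\<^bsub>A\<^esub>"
    using c inv(1) eq by (simp_all add: z_def smult_mult_left smult_mult_right M.minus_eq
        A.l_distr A.r_distr A.l_minus A.r_minus q[unfolded One_nat_def])
qed

end

text \<open>The two pairs induce homomorphisms in opposite directions. By \<open>inv\<close> and
  \<open>inv'\<close> their composites fix the generators, so they are identities by
  \<open>symbol_hom_unique\<close>. The hypotheses range over all \<open>h\<close> because a lift is
  known only by its values on generators.\<close>

lemma cyclic_symbol_isoI:
  assumes S: "symbol_algebra F \<alpha> \<beta>" and S': "symbol_algebra F \<alpha>' \<beta>'"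
    and xy: "cyclic_pair F p (cyclic_symbol F p \<alpha> \<beta>) \<alpha>' \<beta>' x y"
    and xy': "cyclic_pair F p (cyclic_symbol F p \<alpha>' \<beta>') \<alpha> \<beta> x' y'"
    and inv: "\<And>h. h \<in> alg_hom F (cyclic_symbol F p \<alpha> \<beta>) (cyclic_symbol F p \<alpha>' \<beta>') \<Longrightarrow>
      h (symbol_i F p \<alpha> \<beta>) = x' \<Longrightarrow> h (symbol_j F p \<alpha> \<beta>) = y' \<Longrightarrow>
      h x = symbol_i F p \<alpha>' \<beta>' \<and> h y = symbol_j F p \<alpha>' \<beta>'"
    and inv': "\<And>h. h \<in> alg_hom F (cyclic_symbol F p \<alpha>' \<beta>') (cyclic_symbol F p \<alpha> \<beta>) \<Longrightarrow>
      h (symbol_i F p \<alpha>' \<beta>') = x \<Longrightarrow> h (symbol_j F p \<alpha>' \<beta>') = y \<Longrightarrow>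
      h x' = symbol_i F p \<alpha> \<beta> \<and> h y' = symbol_j F p \<alpha> \<beta>"
  shows "algebra_isomorphic F (cyclic_symbol F p \<alpha> \<beta>) (cyclic_symbol F p \<alpha>' \<beta>')"
proof -
  interpret S: symbol_algebra F p \<alpha> \<beta> by (rule S)
  interpret S': symbol_algebra F p \<alpha>' \<beta>' by (rule S')
  obtain f where f: "f \<in> alg_hom F S.S S'.S" "f S.i = x'" "f S.j = y'"
    using S.symbol_lift[OF S'.assoc_algebra_symbol xy'] .
  obtain g where g: "g \<in> alg_hom F S'.S S.S" "g S'.i = x" "g S'.j = y"
    using S'.symbol_lift[OF S.assoc_algebra_symbol xy] .
  have "(g \<circ> f) z = z" if "z \<in> carrier S.S" for z
    by (rule S.symbol_hom_unique[OF alg_hom_comp[OF f(1) g(1)] id_alg_hom _ _ that])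
      (simp_all add: f inv'[OF g])
  moreover have "(f \<circ> g) z = z" if "z \<in> carrier S'.S" for z
    by (rule S'.symbol_hom_unique[OF alg_hom_comp[OF g(1) f(1)] id_alg_hom _ _ that])
      (simp_all add: g inv[OF f])
  ultimately show ?thesis using f(1) g(1) by (intro algebra_isomorphicI[OF f(1) g(1)]) simp_all
qed

section \<open>Isomorphisms between symbols over a field of characteristic p\<close>

locale char_p_field = field F for F (structure) +
  fixes p :: nat
  assumes prime: "prime p" and char: "[p] \<cdot> \<one> = \<zero>"
begin

abbreviation symbol :: "'a \<Rightarrow> 'a \<Rightarrow> ('a, (cyclic_gen list \<Rightarrow> 'a) set) module" where
  "symbol \<equiv> cyclic_symbol F p"

lemma symbol_algebraI: "\<alpha> \<in> carrier F \<Longrightarrow> \<beta> \<in> carrier F \<Longrightarrow> symbol_algebra F \<alpha> \<beta>"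
  by (simp add: symbol_algebra_def symbol_algebra_axioms_def is_cring)

lemma char_p_algebra_symbol:
  assumes "\<alpha> \<in> carrier F" "\<beta> \<in> carrier F"
  shows "char_p_algebra F (symbol \<alpha> \<beta>) p"
proof -
  interpret S: symbol_algebra F p \<alpha> \<beta> by (intro symbol_algebraI assms)
  show ?thesis
    using S.assoc_algebra_symbol field_axioms prime char
    by (simp add: char_p_algebra_def char_p_algebra_axioms_def)
qed

lemma symbol_pair:
  assumes "\<alpha> \<in> carrier F" "\<beta> \<in> carrier F"
  shows "cyclic_pair F p (symbol \<alpha> \<beta>) \<alpha> \<beta> (symbol_i F p \<alpha> \<beta>) (symbol_j F p \<alpha> \<beta>)"
proof -
  interpret S: symbol_algebra F p \<alpha> \<beta> by (intro symbol_algebraI assms)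
  show ?thesis by (rule S.cyclic_pair_symbol)
qed

lemma nat_pow_nonzero: "c \<in> carrier F \<Longrightarrow> c \<noteq> \<zero> \<Longrightarrow> c [^] (n::nat) \<noteq> \<zero>"
  by (induction n) (simp_all add: integral_iff)

text \<open>Frobenius applied to \<open>\<ominus> d \<oplus> d = \<zero>\<close> covers odd
  \<open>p\<close> and \<open>p = 2\<close> together.\<close>

lemma pow_char_a_inv: "d \<in> carrier F \<Longrightarrow> (\<ominus> d) [^] p = \<ominus> (d [^] p)"
proof -
  assume d: "d \<in> carrier F"
  then have "(\<ominus> d \<oplus> d) [^] p = (\<ominus> d) [^] p \<oplus> d [^] p"
    by (intro frobenius_add[OF prime char]) (simp_all add: m_comm)
  moreover have "p > 0" using prime prime_gt_0_nat by blast
  ultimately have "(\<ominus> d) [^] p \<oplus> d [^] p = \<zero>" using d by (simp add: l_neg nat_pow_zero)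
  then show ?thesis using d by (intro sum_zero_eq_neg) simp_all
qed

text \<open>The corrections by \<open>e\<close> and \<open>\<ominus> e\<close> cancel under
  \<open>h\<close>. This verifies inverse changes of generators, with \<open>u\<close> the unit in
  \<open>symbol_iso_shift\<close> and a power of \<open>j\<close> in
  \<open>symbol_iso_add_power\<close>.\<close>

lemma alg_hom_add_smult_inverse:
  assumes A: "assoc_algebra F A" and B: "assoc_algebra F B" and h: "h \<in> alg_hom F A B"
    and c: "x \<in> carrier A" "u \<in> carrier A" "x' \<in> carrier B" "e \<in> carrier F"
    and hx: "h x = x' \<oplus>\<^bsub>B\<^esub> e \<odot>\<^bsub>B\<^esub> h u"
  shows "h (x \<oplus>\<^bsub>A\<^esub> (\<ominus> e) \<odot>\<^bsub>A\<^esub> u) = x'"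
proof -
  interpret A: assoc_algebra F A by (rule A)
  interpret B: assoc_algebra F B by (rule B)
  interpret h: ring_hom_ring A B h
    using alg_hom_ring_hom_ring[OF h A.A.ring_axioms B.A.ring_axioms] .
  show ?thesis using c
    by (simp add: hx alg_hom_smult[OF h] B.smult_l_minus B.M.a_assoc B.M.r_neg)
qed

text \<open>The changes of generator \<open>i + d\<close> and \<open>i - d\<close> undo each other,
  and \<open>d^p - d\<close> changes sign with \<open>d\<close>, so the second one leads back to
  \<open>\<alpha>\<close>.\<close>

lemma symbol_iso_shift:
  assumes F: "\<alpha> \<in> carrier F" "\<beta> \<in> carrier F" "d \<in> carrier F"
  shows "algebra_isomorphic F (symbol \<alpha> \<beta>) (symbol (\<alpha> \<oplus> (d [^] p \<ominus> d)) \<beta>)"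
proof -
  define \<gamma> where "\<gamma> = \<alpha> \<oplus> (d [^] p \<ominus> d)"
  have \<gamma>: "\<gamma> \<in> carrier F" using F by (simp add: \<gamma>_def)
  have "(\<ominus> d) [^] p \<ominus> (\<ominus> d) = \<ominus> (d [^] p \<ominus> d)"
    using F by (simp add: pow_char_a_inv minus_eq minus_add)
  then have bck: "\<gamma> \<oplus> ((\<ominus> d) [^] p \<ominus> (\<ominus> d)) = \<alpha>"
    using F by (simp add: \<gamma>_def a_assoc r_neg)
  interpret S: char_p_algebra F "symbol \<alpha> \<beta>" p using F(1,2) by (rule char_p_algebra_symbol)
  interpret T: char_p_algebra F "symbol \<gamma> \<beta>" p using \<gamma> F(2) by (rule char_p_algebra_symbol)
  note st = symbol_pair[OF F(1,2)] symbol_pair[OF \<gamma> F(2)]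
  note closed = st[unfolded cyclic_pair_def]
  have "algebra_isomorphic F (symbol \<alpha> \<beta>) (symbol \<gamma> \<beta>)"
  proof (rule cyclic_symbol_isoI[OF symbol_algebraI[OF F(1,2)] symbol_algebraI[OF \<gamma> F(2)]])
    show "cyclic_pair F p (symbol \<alpha> \<beta>) \<gamma> \<beta>
        (symbol_i F p \<alpha> \<beta> \<oplus>\<^bsub>symbol \<alpha> \<beta>\<^esub> d \<odot>\<^bsub>symbol \<alpha> \<beta>\<^esub> \<one>\<^bsub>symbol \<alpha> \<beta>\<^esub>) (symbol_j F p \<alpha> \<beta>)"
      unfolding \<gamma>_def by (rule S.cyclic_pair_shift[OF st(1) F(1,3)])
    show "cyclic_pair F p (symbol \<gamma> \<beta>) \<alpha> \<beta>
        (symbol_i F p \<gamma> \<beta> \<oplus>\<^bsub>symbol \<gamma> \<beta>\<^esub> (\<ominus> d) \<odot>\<^bsub>symbol \<gamma> \<beta>\<^esub> \<one>\<^bsub>symbol \<gamma> \<beta>\<^esub>) (symbol_j F p \<gamma> \<beta>)"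
      using T.cyclic_pair_shift[OF st(2) \<gamma>, of "\<ominus> d"] F(3) by (simp add: bck)
  next
    fix h assume h: "h \<in> alg_hom F (symbol \<alpha> \<beta>) (symbol \<gamma> \<beta>)"
      "h (symbol_i F p \<alpha> \<beta>) =
        symbol_i F p \<gamma> \<beta> \<oplus>\<^bsub>symbol \<gamma> \<beta>\<^esub> (\<ominus> d) \<odot>\<^bsub>symbol \<gamma> \<beta>\<^esub> \<one>\<^bsub>symbol \<gamma> \<beta>\<^esub>"
      "h (symbol_j F p \<alpha> \<beta>) = symbol_j F p \<gamma> \<beta>"
    have "h \<one>\<^bsub>symbol \<alpha> \<beta>\<^esub> = \<one>\<^bsub>symbol \<gamma> \<beta>\<^esub>" using h(1) by (simp add: alg_hom_def ring_hom_def)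
    with h show "h (symbol_i F p \<alpha> \<beta> \<oplus>\<^bsub>symbol \<alpha> \<beta>\<^esub> d \<odot>\<^bsub>symbol \<alpha> \<beta>\<^esub> \<one>\<^bsub>symbol \<alpha> \<beta>\<^esub>) = symbol_i F p \<gamma> \<beta> \<and>
        h (symbol_j F p \<alpha> \<beta>) = symbol_j F p \<gamma> \<beta>"
      using alg_hom_add_smult_inverse[OF S.assoc_algebra_axioms T.assoc_algebra_axioms h(1),
          of "symbol_i F p \<alpha> \<beta>" "\<one>\<^bsub>symbol \<alpha> \<beta>\<^esub>" "symbol_i F p \<gamma> \<beta>" "\<ominus> d"] closed F(3)
      by simp
  next
    fix h assume h: "h \<in> alg_hom F (symbol \<gamma> \<beta>) (symbol \<alpha> \<beta>)"
      "h (symbol_i F p \<gamma> \<beta>) =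
        symbol_i F p \<alpha> \<beta> \<oplus>\<^bsub>symbol \<alpha> \<beta>\<^esub> d \<odot>\<^bsub>symbol \<alpha> \<beta>\<^esub> \<one>\<^bsub>symbol \<alpha> \<beta>\<^esub>"
      "h (symbol_j F p \<gamma> \<beta>) = symbol_j F p \<alpha> \<beta>"
    have "h \<one>\<^bsub>symbol \<gamma> \<beta>\<^esub> = \<one>\<^bsub>symbol \<alpha> \<beta>\<^esub>" using h(1) by (simp add: alg_hom_def ring_hom_def)
    with h show "h (symbol_i F p \<gamma> \<beta> \<oplus>\<^bsub>symbol \<gamma> \<beta>\<^esub> (\<ominus> d) \<odot>\<^bsub>symbol \<gamma> \<beta>\<^esub> \<one>\<^bsub>symbol \<gamma> \<beta>\<^esub>) = symbol_i F p \<alpha> \<beta> \<and>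
        h (symbol_j F p \<gamma> \<beta>) = symbol_j F p \<alpha> \<beta>"
      using alg_hom_add_smult_inverse[OF T.assoc_algebra_axioms S.assoc_algebra_axioms h(1),
          of "symbol_i F p \<gamma> \<beta>" "\<one>\<^bsub>symbol \<gamma> \<beta>\<^esub>" "symbol_i F p \<alpha> \<beta>" d] closed F(3)
      by simp
  qed
  then show ?thesis by (simp add: \<gamma>_def)
qed

lemma symbol_iso_add_power:
  assumes F: "\<alpha> \<in> carrier F" "\<beta> \<in> carrier F" "\<beta> \<noteq> \<zero>" "\<gamma> \<in> carrier F" "c \<in> carrier F"
    and \<gamma>\<beta>: "\<gamma> \<otimes> \<beta> = \<alpha> \<otimes> \<beta> \<oplus> c [^] p"
  shows "algebra_isomorphic F (symbol \<alpha> \<beta>) (symbol \<gamma> \<beta>)"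
proof -
  \<comment> \<open>As \<open>j^(p-1)\<close> is \<open>\<beta>\<close> times the inverse of
    \<open>j\<close>, the element \<open>e j^(p-1)\<close> is \<open>c\<close> times that inverse.
    The change of generator with \<open>\<ominus> e\<close> goes back.\<close>
  define e where "e = c \<otimes> inv \<beta>"
  have inv: "inv \<beta> \<in> carrier F" "inv \<beta> \<otimes> \<beta> = \<one>" using F by (simp_all add: field_Units)
  have e: "e \<in> carrier F" using F inv by (simp add: e_def)
  have e\<beta>: "e \<otimes> \<beta> = c" using F inv by (simp add: e_def m_assoc)
  have bck: "\<alpha> \<otimes> \<beta> = \<gamma> \<otimes> \<beta> \<oplus> ((\<ominus> e) \<otimes> \<beta>) [^] p"
    using F e by (simp add: \<gamma>\<beta> e\<beta> l_minus pow_char_a_inv a_assoc r_neg)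
  interpret S: char_p_algebra F "symbol \<alpha> \<beta>" p using F(1,2) by (rule char_p_algebra_symbol)
  interpret T: char_p_algebra F "symbol \<gamma> \<beta>" p using F(4,2) by (rule char_p_algebra_symbol)
  note st = symbol_pair[OF F(1,2)] symbol_pair[OF F(4,2)]
  note closed = st[unfolded cyclic_pair_def]
  define u where "u = symbol_j F p \<alpha> \<beta> [^]\<^bsub>symbol \<alpha> \<beta>\<^esub> (p - 1)"
  define v where "v = symbol_j F p \<gamma> \<beta> [^]\<^bsub>symbol \<gamma> \<beta>\<^esub> (p - 1)"
  have uv: "u \<in> carrier (symbol \<alpha> \<beta>)" "v \<in> carrier (symbol \<gamma> \<beta>)"
    using closed by (simp_all add: u_def v_def)
  show ?thesis
  proof (rule cyclic_symbol_isoI[OF symbol_algebraI[OF F(1,2)] symbol_algebraI[OF F(4,2)]])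
    show "cyclic_pair F p (symbol \<alpha> \<beta>) \<gamma> \<beta>
        (symbol_i F p \<alpha> \<beta> \<oplus>\<^bsub>symbol \<alpha> \<beta>\<^esub> e \<odot>\<^bsub>symbol \<alpha> \<beta>\<^esub> u) (symbol_j F p \<alpha> \<beta>)"
      unfolding u_def using \<gamma>\<beta> by (intro S.cyclic_pair_add_power[OF st(1) F(1-3) e F(4)]) (simp add: e\<beta>)
    show "cyclic_pair F p (symbol \<gamma> \<beta>) \<alpha> \<beta>
        (symbol_i F p \<gamma> \<beta> \<oplus>\<^bsub>symbol \<gamma> \<beta>\<^esub> (\<ominus> e) \<odot>\<^bsub>symbol \<gamma> \<beta>\<^esub> v) (symbol_j F p \<gamma> \<beta>)"
      unfolding v_def using bck e by (intro T.cyclic_pair_add_power[OF st(2) F(4,2,3) _ F(1)]) simp_all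
  next
    fix h assume h: "h \<in> alg_hom F (symbol \<alpha> \<beta>) (symbol \<gamma> \<beta>)"
      "h (symbol_i F p \<alpha> \<beta>) =
        symbol_i F p \<gamma> \<beta> \<oplus>\<^bsub>symbol \<gamma> \<beta>\<^esub> (\<ominus> e) \<odot>\<^bsub>symbol \<gamma> \<beta>\<^esub> v"
      "h (symbol_j F p \<alpha> \<beta>) = symbol_j F p \<gamma> \<beta>"
    interpret h: ring_hom_ring "symbol \<alpha> \<beta>" "symbol \<gamma> \<beta>" h
      using alg_hom_ring_hom_ring[OF h(1) S.A.ring_axioms T.A.ring_axioms] .
    have "h u = v" using closed by (simp add: u_def v_def h.hom_nat_pow h(3))
    with h show "h (symbol_i F p \<alpha> \<beta> \<oplus>\<^bsub>symbol \<alpha> \<beta>\<^esub> e \<odot>\<^bsub>symbol \<alpha> \<beta>\<^esub> u) = symbol_i F p \<gamma> \<beta> \<and>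
        h (symbol_j F p \<alpha> \<beta>) = symbol_j F p \<gamma> \<beta>"
      using alg_hom_add_smult_inverse[OF S.assoc_algebra_axioms T.assoc_algebra_axioms h(1),
          of "symbol_i F p \<alpha> \<beta>" u "symbol_i F p \<gamma> \<beta>" "\<ominus> e"] closed uv e
      by simp
  next
    fix h assume h: "h \<in> alg_hom F (symbol \<gamma> \<beta>) (symbol \<alpha> \<beta>)"
      "h (symbol_i F p \<gamma> \<beta>) =
        symbol_i F p \<alpha> \<beta> \<oplus>\<^bsub>symbol \<alpha> \<beta>\<^esub> e \<odot>\<^bsub>symbol \<alpha> \<beta>\<^esub> u"
      "h (symbol_j F p \<gamma> \<beta>) = symbol_j F p \<alpha> \<beta>"
    interpret h: ring_hom_ring "symbol \<gamma> \<beta>" "symbol \<alpha> \<beta>" h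
      using alg_hom_ring_hom_ring[OF h(1) T.A.ring_axioms S.A.ring_axioms] .
    have "h v = u" using closed by (simp add: u_def v_def h.hom_nat_pow h(3))
    with h show "h (symbol_i F p \<gamma> \<beta> \<oplus>\<^bsub>symbol \<gamma> \<beta>\<^esub> (\<ominus> e) \<odot>\<^bsub>symbol \<gamma> \<beta>\<^esub> v) = symbol_i F p \<alpha> \<beta> \<and>
        h (symbol_j F p \<gamma> \<beta>) = symbol_j F p \<alpha> \<beta>"
      using alg_hom_add_smult_inverse[OF T.assoc_algebra_axioms S.assoc_algebra_axioms h(1),
          of "symbol_i F p \<gamma> \<beta>" v "symbol_i F p \<alpha> \<beta>" e] closed uv e
      by simp
  qed
qed

text \<open>The generator \<open>j\<close> is replaced by \<open>i j\<close>, and in the opposite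
  direction by the product of the inverse of \<open>i\<close> with \<open>j\<close>; the inverse
  exists because \<open>\<alpha> \<noteq> \<zero>\<close>.\<close>

lemma symbol_iso_mult_left:
  assumes F: "\<alpha> \<in> carrier F" "\<beta> \<in> carrier F" "\<alpha> \<noteq> \<zero>"
  shows "algebra_isomorphic F (symbol \<alpha> \<beta>) (symbol \<alpha> (\<alpha> \<otimes> \<beta>))"
proof -
  define \<gamma> where "\<gamma> = \<alpha> \<otimes> \<beta>"
  have \<gamma>: "\<gamma> \<in> carrier F" using F by (simp add: \<gamma>_def)
  interpret S: char_p_algebra F "symbol \<alpha> \<beta>" p using F(1,2) by (rule char_p_algebra_symbol)
  interpret T: char_p_algebra F "symbol \<alpha> \<gamma>" p using F(1) \<gamma> by (rule char_p_algebra_symbol)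
  note st = symbol_pair[OF F(1,2)] symbol_pair[OF F(1) \<gamma>]
  note closed = st[unfolded cyclic_pair_def]
  define u where "u = inv \<alpha> \<odot>\<^bsub>symbol \<alpha> \<beta>\<^esub>
    (symbol_i F p \<alpha> \<beta> [^]\<^bsub>symbol \<alpha> \<beta>\<^esub> (p - 1) \<ominus>\<^bsub>symbol \<alpha> \<beta>\<^esub> \<one>\<^bsub>symbol \<alpha> \<beta>\<^esub>)"
  define v where "v = inv \<alpha> \<odot>\<^bsub>symbol \<alpha> \<gamma>\<^esub>
    (symbol_i F p \<alpha> \<gamma> [^]\<^bsub>symbol \<alpha> \<gamma>\<^esub> (p - 1) \<ominus>\<^bsub>symbol \<alpha> \<gamma>\<^esub> \<one>\<^bsub>symbol \<alpha> \<gamma>\<^esub>)"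
  note u = S.cyclic_pair_inverse[OF st(1) F(1,3), folded u_def]
    and v = T.cyclic_pair_inverse[OF st(2) F(1,3), folded v_def]
  have inv: "inv \<alpha> \<in> carrier F" using F by (simp add: field_Units)
  have "algebra_isomorphic F (symbol \<alpha> \<beta>) (symbol \<alpha> \<gamma>)"
  proof (rule cyclic_symbol_isoI[OF symbol_algebraI[OF F(1,2)] symbol_algebraI[OF F(1) \<gamma>]])
    show "cyclic_pair F p (symbol \<alpha> \<beta>) \<alpha> \<gamma> (symbol_i F p \<alpha> \<beta>)
        (symbol_i F p \<alpha> \<beta> \<otimes>\<^bsub>symbol \<alpha> \<beta>\<^esub> symbol_j F p \<alpha> \<beta>)"
      using S.cyclic_pair_mult_left[OF st(1) F(1,2)] by (simp add: \<gamma>_def)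
    show "cyclic_pair F p (symbol \<alpha> \<gamma>) \<alpha> \<beta> (symbol_i F p \<alpha> \<gamma>)
        (v \<otimes>\<^bsub>symbol \<alpha> \<gamma>\<^esub> symbol_j F p \<alpha> \<gamma>)"
      using T.cyclic_pair_mult_inverse[OF _ F v] st(2) by (simp add: \<gamma>_def)
  next
    fix h assume h: "h \<in> alg_hom F (symbol \<alpha> \<beta>) (symbol \<alpha> \<gamma>)"
      "h (symbol_i F p \<alpha> \<beta>) = symbol_i F p \<alpha> \<gamma>"
      "h (symbol_j F p \<alpha> \<beta>) = v \<otimes>\<^bsub>symbol \<alpha> \<gamma>\<^esub> symbol_j F p \<alpha> \<gamma>"
    interpret h: ring_hom_ring "symbol \<alpha> \<beta>" "symbol \<alpha> \<gamma>" h
      using alg_hom_ring_hom_ring[OF h(1) S.A.ring_axioms T.A.ring_axioms] .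
    show "h (symbol_i F p \<alpha> \<beta>) = symbol_i F p \<alpha> \<gamma> \<and>
        h (symbol_i F p \<alpha> \<beta> \<otimes>\<^bsub>symbol \<alpha> \<beta>\<^esub> symbol_j F p \<alpha> \<beta>) = symbol_j F p \<alpha> \<gamma>"
      using closed v by (simp add: h(2,3) flip: T.A.m_assoc)
  next
    fix h assume h: "h \<in> alg_hom F (symbol \<alpha> \<gamma>) (symbol \<alpha> \<beta>)"
      "h (symbol_i F p \<alpha> \<gamma>) = symbol_i F p \<alpha> \<beta>"
      "h (symbol_j F p \<alpha> \<gamma>) = symbol_i F p \<alpha> \<beta> \<otimes>\<^bsub>symbol \<alpha> \<beta>\<^esub> symbol_j F p \<alpha> \<beta>"
    interpret h: ring_hom_ring "symbol \<alpha> \<gamma>" "symbol \<alpha> \<beta>" h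
      using alg_hom_ring_hom_ring[OF h(1) T.A.ring_axioms S.A.ring_axioms] .
    \<comment> \<open>Both inverses are the same polynomial expression in the respective generator
      \<open>i\<close>, and \<open>h\<close> maps one generator to the other.\<close>
    have "h v = u" using closed inv
      by (simp add: u_def v_def alg_hom_smult[OF h(1)] h.hom_minus h.hom_nat_pow h(2))
    then show "h (symbol_i F p \<alpha> \<gamma>) = symbol_i F p \<alpha> \<beta> \<and>
        h (v \<otimes>\<^bsub>symbol \<alpha> \<gamma>\<^esub> symbol_j F p \<alpha> \<gamma>) = symbol_j F p \<alpha> \<beta>"
      using closed u v by (simp add: h(2,3) flip: S.A.m_assoc)
  qed
  then show ?thesis by (simp add: \<gamma>_def)
qed

section \<open>Linking symbols and building the chain\<close>

lemma symbol_iso_nonzero: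
  assumes F: "\<alpha> \<in> carrier F" "\<beta> \<in> carrier F - {\<zero>}"
  obtains \<gamma> where "\<gamma> \<in> carrier F - {\<zero>}" "algebra_isomorphic F (symbol \<alpha> \<beta>) (symbol \<gamma> \<beta>)"
proof (cases "\<alpha> = \<zero>")
  case True
  have inv: "inv \<beta> \<in> carrier F" "inv \<beta> \<otimes> \<beta> = \<one>" "inv \<beta> \<noteq> \<zero>" using F field_Units by auto
  \<comment> \<open>For \<open>c = \<one>\<close> the change by \<open>c^p/\<beta>\<close> moves the
    first slot from zero to the nonzero element \<open>inv \<beta>\<close>.\<close>
  have "algebra_isomorphic F (symbol \<alpha> \<beta>) (symbol (inv \<beta>) \<beta>)"
    using F inv True by (intro symbol_iso_add_power[where c = \<one>]) simp_all
  with that inv show thesis by blast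
next
  case False
  have "algebra_isomorphic F (symbol \<alpha> \<beta>) (symbol \<alpha> \<beta>)"
    unfolding algebra_isomorphic_def using ring_iso_set_refl by (metis id_apply)
  with that F False show thesis by blast
qed

text \<open>If \<open>\<alpha>\<beta> + d\<^sup>p\<close> vanishes for \<open>d = \<gamma> - \<alpha>\<beta>\<close>, then the first slot can be moved to \<open>0\<close>, where
  the corresponding value \<open>\<gamma>\<^sup>p\<close> is nonzero.\<close>

lemma symbol_iso_good_slot:
  assumes F: "\<alpha> \<in> carrier F" "\<beta> \<in> carrier F - {\<zero>}" "\<gamma> \<in> carrier F - {\<zero>}"
  obtains \<alpha>' where "\<alpha>' \<in> carrier F" "algebra_isomorphic F (symbol \<alpha> \<beta>) (symbol \<alpha>' \<beta>)"
    "\<alpha>' \<otimes> \<beta> \<oplus> (\<gamma> \<ominus> \<alpha>' \<otimes> \<beta>) [^] p \<noteq> \<zero>"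
proof (cases "\<alpha> \<otimes> \<beta> \<oplus> (\<gamma> \<ominus> \<alpha> \<otimes> \<beta>) [^] p = \<zero>")
  case True
  have "algebra_isomorphic F (symbol \<alpha> \<beta>) (symbol \<zero> \<beta>)"
    \<comment> \<open>The case assumption says exactly that the first slot changed with this
      \<open>c\<close> has product zero with \<open>\<beta>\<close>.\<close>
    using F True by (intro symbol_iso_add_power[where c = "\<gamma> \<ominus> \<alpha> \<otimes> \<beta>"]) simp_all
  moreover have "\<gamma> [^] p \<noteq> \<zero>" using F by (simp add: nat_pow_nonzero)
  ultimately show thesis using F by (intro that[of \<zero>]) (simp_all add: minus_eq)
next
  case False
  have "algebra_isomorphic F (symbol \<alpha> \<beta>) (symbol \<alpha> \<beta>)"
    unfolding algebra_isomorphic_def using ring_iso_set_refl by (metis id_apply)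
  with that F False show thesis by blast
qed

text \<open>The element \<open>b\<close> arises from the left symbol and also as a shift of
  \<open>\<gamma>\<close>. The claim on the right is for every \<open>\<delta>\<close>, since the
  second slot there is fixed by the rest of the chain.\<close>

lemma symbol_link:
  assumes F: "\<alpha> \<in> carrier F" "\<beta> \<in> carrier F - {\<zero>}" "\<gamma> \<in> carrier F - {\<zero>}"
  obtains a b where "a \<in> carrier F - {\<zero>}" "b \<in> carrier F - {\<zero>}"
    "algebra_isomorphic F (symbol \<alpha> \<beta>) (symbol a b)"
    "\<And>\<delta>. \<delta> \<in> carrier F \<Longrightarrow> algebra_isomorphic F (symbol \<gamma> \<delta>) (symbol b \<delta>)"
proof -
  obtain \<alpha>' where \<alpha>': "\<alpha>' \<in> carrier F" "algebra_isomorphic F (symbol \<alpha> \<beta>) (symbol \<alpha>' \<beta>)"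
    "\<alpha>' \<otimes> \<beta> \<oplus> (\<gamma> \<ominus> \<alpha>' \<otimes> \<beta>) [^] p \<noteq> \<zero>"
    using symbol_iso_good_slot[OF F] .
  define d where "d = \<gamma> \<ominus> \<alpha>' \<otimes> \<beta>"
  define b where "b = \<alpha>' \<otimes> \<beta> \<oplus> d [^] p"
  \<comment> \<open>With \<open>a \<beta> = b\<close>, multiplying the second slot
    \<open>\<beta>\<close> by the nonzero first slot \<open>a\<close> produces
    \<open>b\<close>.\<close>
  define a where "a = b \<otimes> inv \<beta>"
  have inv: "inv \<beta> \<in> carrier F" "inv \<beta> \<otimes> \<beta> = \<one>" "inv \<beta> \<noteq> \<zero>" using F field_Units by auto
  have d: "d \<in> carrier F" using F \<alpha>' by (simp add: d_def)
  have b: "b \<in> carrier F - {\<zero>}" using F \<alpha>' by (simp add: b_def d_def)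
  have a: "a \<in> carrier F - {\<zero>}" using b inv by (simp add: a_def integral_iff)
  have ab: "a \<otimes> \<beta> = b" using F b inv by (simp add: a_def m_assoc)
  have b': "b = \<gamma> \<oplus> (d [^] p \<ominus> d)"
  proof -
    have "\<alpha>' \<otimes> \<beta> = \<gamma> \<ominus> d"
      unfolding d_def using F \<alpha>' by (simp add: minus_eq minus_add a_assoc[symmetric] r_neg)
    then show ?thesis using F d by (simp add: b_def minus_eq a_ac)
  qed
  have "algebra_isomorphic F (symbol \<alpha>' \<beta>) (symbol a \<beta>)"
    using F \<alpha>' a d ab by (intro symbol_iso_add_power[where c = d]) (simp_all add: b_def)
  moreover have "algebra_isomorphic F (symbol a \<beta>) (symbol a b)"
    using symbol_iso_mult_left[of a \<beta>] a F ab by simp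
  ultimately have "algebra_isomorphic F (symbol \<alpha> \<beta>) (symbol a b)"
    using \<alpha>'(2) algebra_isomorphic_trans by blast
  moreover have "algebra_isomorphic F (symbol \<gamma> \<delta>) (symbol b \<delta>)" if "\<delta> \<in> carrier F" for \<delta>
    unfolding b' using F d that by (intro symbol_iso_shift) simp_all
  ultimately show thesis using that a b by blast
qed

text \<open>Induction at the left end: the chain for the algebras from the second one on comes
  first, and \<open>symbol_link\<close> then joins the first algebra to it.\<close>

lemma symbol_chain:
  fixes n :: nat
  assumes "n \<ge> 1" and "\<And>i. i \<in> {1..n} \<Longrightarrow> \<alpha> i \<in> carrier F"
    and "\<And>i. i \<in> {1..n} \<Longrightarrow> \<beta> i \<in> carrier F - {\<zero>}"
  shows "\<exists>a. (\<forall>i \<in> {0..n}. a i \<in> carrier F - {\<zero>}) \<and>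
    (\<forall>i \<in> {1..n}. algebra_isomorphic F (symbol (\<alpha> i) (\<beta> i)) (symbol (a (i - 1)) (a i)))"
  using assms
proof (induction n arbitrary: \<alpha> \<beta> rule: nat_induct_at_least)
  case base
  then obtain \<gamma> where "\<gamma> \<in> carrier F - {\<zero>}" "algebra_isomorphic F (symbol (\<alpha> 1) (\<beta> 1)) (symbol \<gamma> (\<beta> 1))"
    using symbol_iso_nonzero[of "\<alpha> 1" "\<beta> 1"] by auto
  then show ?case using base by (intro exI[of _ "\<lambda>i. if i = 0 then \<gamma> else \<beta> 1"]) auto
next
  case (Suc n)
  obtain a where a: "\<forall>i \<in> {0..n}. a i \<in> carrier F - {\<zero>}"
    "\<forall>i \<in> {1..n}. algebra_isomorphic F (symbol (\<alpha> (Suc i)) (\<beta> (Suc i))) (symbol (a (i - 1)) (a i))"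
    using Suc.IH[of "\<lambda>i. \<alpha> (Suc i)" "\<lambda>i. \<beta> (Suc i)"] Suc.prems by auto
  obtain u b where ub: "u \<in> carrier F - {\<zero>}" "b \<in> carrier F - {\<zero>}"
    "algebra_isomorphic F (symbol (\<alpha> 1) (\<beta> 1)) (symbol u b)"
    "\<And>\<delta>. \<delta> \<in> carrier F \<Longrightarrow> algebra_isomorphic F (symbol (a 0) \<delta>) (symbol b \<delta>)"
    using symbol_link[of "\<alpha> 1" "\<beta> 1" "a 0"] Suc.prems a(1) by auto
  \<comment> \<open>The old chain moves up by one index, \<open>b\<close> takes the place of
    \<open>a 0\<close>, and \<open>u\<close> is put in front.\<close>
  define a' where "a' = (\<lambda>i. if i = 0 then u else if i = 1 then b else a (i - 1))"
  have "a' i \<in> carrier F - {\<zero>}" if "i \<in> {0..Suc n}" for i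
    using that a(1) ub(1,2) by (auto simp: a'_def)
  moreover have "algebra_isomorphic F (symbol (\<alpha> i) (\<beta> i)) (symbol (a' (i - 1)) (a' i))"
    if i: "i \<in> {1..Suc n}" for i
  proof -
    \<comment> \<open>Among the moved symbols only the one at index 2 involves the replaced entry
      \<open>a 0\<close>; later ones are taken over unchanged.\<close>
    consider "i = 1" | "i = 2" "n \<ge> 1" | "i > 2" using i Suc.hyps by force
    then show ?thesis
    proof cases
      case 1
      then show ?thesis using ub(3) by (simp add: a'_def)
    next
      case 2
      have "algebra_isomorphic F (symbol (\<alpha> i) (\<beta> i)) (symbol (a 0) (a 1))"
        using a(2)[rule_format, of 1] 2 by (simp add: numeral_2_eq_2)
      moreover have "algebra_isomorphic F (symbol (a 0) (a 1)) (symbol b (a 1))"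
        using ub(4) a(1) 2 by simp
      ultimately show ?thesis using 2 algebra_isomorphic_trans by (auto simp: a'_def)
    next
      case 3
      then have "i - 1 \<in> {1..n}" using i by auto
      then show ?thesis using a(2)[rule_format, of "i - 1"] 3 by (auto simp: a'_def)
    qed
  qed
  ultimately show ?case by blast
qed

end

text \<open>The numbers annihilating the unit are the multiples of its additive order, with 0
  standing for infinite order, so their \<open>Gcd\<close> is that order.\<close>

lemma ring_char_eqD:
  assumes "ring R" "ring_char R = p"
  shows "[p] \<cdot>\<^bsub>R\<^esub> \<one>\<^bsub>R\<^esub> = \<zero>\<^bsub>R\<^esub>"
proof -
  interpret ring R by fact
  let ?d = "group.ord (add_monoid R) \<one>\<^bsub>R\<^esub>"
  have "{n::nat. [n] \<cdot>\<^bsub>R\<^esub> \<one>\<^bsub>R\<^esub> = \<zero>\<^bsub>R\<^esub>} = {n. ?d dvd n}"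
    using group.pow_eq_id[OF a_group, of "\<one>\<^bsub>R\<^esub>"] by (simp add: add_pow_def)
  moreover have "Gcd {n. ?d dvd n} = ?d"
    by (rule Gcd_eqI) auto
  ultimately have "?d = p" using assms(2) by (simp add: ring_char_def)
  then show ?thesis using group.pow_eq_id[OF a_group, of "\<one>\<^bsub>R\<^esub>" p] by (simp add: add_pow_def)
qed

theorem theorem2p1:
  fixes F :: "('a, 'm) ring_scheme"
    and A :: "nat \<Rightarrow> ('a, 'b, 'k) module_scheme"
    and p n :: nat
  assumes "prime p"
    and "field F"
    and "ring_char F = p"
    and "n \<ge> 1"
    and "\<And>i. i \<in> {1..n} \<Longrightarrow> cyclic_p_algebra F p (A i)"
  shows "\<exists>a :: nat \<Rightarrow> 'a.
    (\<forall>i \<in> {0..n}. a i \<in> carrier F - {\<zero>\<^bsub>F\<^esub>}) \<and>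
    (\<forall>i \<in> {1..n}. algebra_isomorphic F (A i) (cyclic_symbol F p (a (i - 1)) (a i)))"
proof -
  interpret field F by fact
  interpret char_p_field F p
    using assms(1,2) ring_char_eqD[OF ring_axioms assms(3)]
    by (simp add: char_p_field_def char_p_field_axioms_def)
  \<comment> \<open>The range condition stands inside the existential quantifiers so that choice
    yields functions defined on all indices.\<close>
  have "\<forall>i. \<exists>\<alpha> \<beta>. i \<in> {1..n} \<longrightarrow> \<alpha> \<in> carrier F \<and> \<beta> \<in> carrier F - {\<zero>\<^bsub>F\<^esub>} \<and>
      algebra_isomorphic F (A i) (cyclic_symbol F p \<alpha> \<beta>)"
    using assms(5) unfolding cyclic_p_algebra_def by blast
  then obtain \<alpha> \<beta> where *: "\<And>i. i \<in> {1..n} \<Longrightarrow> \<alpha> i \<in> carrier F"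
    "\<And>i. i \<in> {1..n} \<Longrightarrow> \<beta> i \<in> carrier F - {\<zero>\<^bsub>F\<^esub>}"
    "\<And>i. i \<in> {1..n} \<Longrightarrow> algebra_isomorphic F (A i) (cyclic_symbol F p (\<alpha> i) (\<beta> i))"
    by metis
  obtain a where a: "\<forall>i \<in> {0..n}. a i \<in> carrier F - {\<zero>\<^bsub>F\<^esub>}"
    "\<forall>i \<in> {1..n}. algebra_isomorphic F (symbol (\<alpha> i) (\<beta> i)) (symbol (a (i - 1)) (a i))"
    using symbol_chain[of n \<alpha> \<beta>] assms(4) *(1,2) by blast
  have "algebra_isomorphic F (A i) (symbol (a (i - 1)) (a i))" if "i \<in> {1..n}" for i
    using *(3)[OF that] a(2)[rule_format, OF that] by (rule algebra_isomorphic_trans)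
  with a(1) show ?thesis by blast
qed

end
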